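(* Let $(X_t)_{t\in\mathbb{N}}$ be i.i.d. random variables with mean $\mu$ and finite standard deviation $\sigma>0$, and let $S_t=X_1+\dots+X_t$. For each $\delta$, let $(\tau_n)_{n\in\mathbb{N}}$ be a renewal process of $\mathbb{N}$-valued random times, with $\tau_0=0$, with i.i.d. positive increments distributed as $\tau=\tau_1$, and with $\mathsf{E}[\tau]=\delta$. Let $N(t)=\max\{n:\tau_n\le t\}$, $\tau(t)=\tau_{N(t)}$, and $$\bar\mu_t=\frac{S_{\tau(t)}}{\tau(t)},\qquad \tilde\mu_t=\frac{S_{\tau(t)}}{t}.$$ Suppose that $\mathsf{Var}[\tau]=O(\delta^2)$ as $\delta\to\infty$. (i) If $\delta,t\to\infty$ so that $\delta=o(t)$, then $\bar\mu_t\to\mu$ in probability and $$\frac{\bar\mu_t-\mu}{\sigma/\sqrt t}\longrightarrow\mathcal{N}(0,1)\quad\text{in distribution}.$$ (ii) If $\delta,t\to\infty$ so that $\delta=o(t)$, then $\tilde\mu_t\to\mu$ in probability. If also $\delta=o(\sqrt t)$, then $$\frac{\tilde\mu_t-\mu}{\sigma/\sqrt t}\longrightarrow\mathcal{N}(0,1)\quad\text{in distribution}.$$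
   Context: The law of $(X_t)$ is fixed, while the law of $\tau$ depends on $\delta$. No independence between $(X_t)$ and $(\tau_n)$ is assumed. $S_0=0$; $\bar\mu_t$ is defined only when $t\ge\tau_1$ (on the complementary event it may be given any value). A statement "as $\delta,t\to\infty$ so that $\delta=o(t)$" refers to any joint limit in which $\delta\to\infty$, $t\to\infty$ and $\delta/t\to0$. *)

theory Defs
  imports "HOL-Probability.Probability" "HOL-Library.Landau_Symbols"
begin

definition iid :: "'a measure \<Rightarrow> 'b measure \<Rightarrow> 'b measure \<Rightarrow> 'i set \<Rightarrow> ('i \<Rightarrow> 'a \<Rightarrow> 'b) \<Rightarrow> bool" where
  "iid M N \<nu> I X \<longleftrightarrow>
     prob_space.indep_vars M (\<lambda>_. N) X I \<and> (\<forall>i\<in>I. distr M N (X i) = \<nu>)"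

text \<open>
  The natural-number subtraction below is harmless: the process is required to be strictly
  increasing, which is the positivity of the increments.
\<close>

definition renewal_process :: "'a measure \<Rightarrow> (nat \<Rightarrow> 'a \<Rightarrow> nat) \<Rightarrow> bool" where
  "renewal_process M \<tau> \<longleftrightarrow>
     (\<forall>\<omega>\<in>space M. \<tau> 0 \<omega> = 0) \<and>
     (\<forall>n. \<forall>\<omega>\<in>space M. \<tau> n \<omega> < \<tau> (Suc n) \<omega>) \<and>
     iid M (count_space UNIV) (distr M (count_space UNIV) (\<tau> 1)) UNIV
       (\<lambda>n \<omega>. \<tau> (Suc n) \<omega> - \<tau> n \<omega>)"

definition renewal_count :: "(nat \<Rightarrow> 'a \<Rightarrow> nat) \<Rightarrow> nat \<Rightarrow> 'a \<Rightarrow> nat" where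
  "renewal_count \<tau> t \<omega> = Max {n. \<tau> n \<omega> \<le> t}"

definition last_renewal :: "(nat \<Rightarrow> 'a \<Rightarrow> nat) \<Rightarrow> nat \<Rightarrow> 'a \<Rightarrow> nat" where
  "last_renewal \<tau> t \<omega> = \<tau> (renewal_count \<tau> t \<omega>) \<omega>"

text \<open>The sequence of summands starts at index 1; the value \<^term>\<open>X 0\<close> is never used.\<close>

definition partial_sum :: "(nat \<Rightarrow> 'a \<Rightarrow> real) \<Rightarrow> nat \<Rightarrow> 'a \<Rightarrow> real" where
  "partial_sum X t \<omega> = (\<Sum>i=1..t. X i \<omega>)"

text \<open>
  The argument \<^term>\<open>v\<close> supplies the values of \<^term>\<open>mu_bar v X \<tau> t\<close> on the event that no
  renewal has occurred by time \<^term>\<open>t\<close>, where the quotient is undefined.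
\<close>

definition mu_bar ::
  "('a \<Rightarrow> real) \<Rightarrow> (nat \<Rightarrow> 'a \<Rightarrow> real) \<Rightarrow> (nat \<Rightarrow> 'a \<Rightarrow> nat) \<Rightarrow> nat \<Rightarrow> 'a \<Rightarrow> real" where
  "mu_bar v X \<tau> t \<omega> =
     (if \<tau> 1 \<omega> \<le> t
      then partial_sum X (last_renewal \<tau> t \<omega>) \<omega> / real (last_renewal \<tau> t \<omega>)
      else v \<omega>)"

definition mu_tilde ::
  "(nat \<Rightarrow> 'a \<Rightarrow> real) \<Rightarrow> (nat \<Rightarrow> 'a \<Rightarrow> nat) \<Rightarrow> nat \<Rightarrow> 'a \<Rightarrow> real" where
  "mu_tilde X \<tau> t \<omega> = partial_sum X (last_renewal \<tau> t \<omega>) \<omega> / real t"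

text \<open>
  A joint limit of the parameters is a filter on pairs \<^term>\<open>(\<delta>, t)\<close>; for instance, a
  sequence of pairs \<^term>\<open>p\<close> gives \<^term>\<open>filtermap p sequentially\<close>. The set \<^term>\<open>D\<close> contains
  the parameters for which a renewal process is given.
\<close>

definition joint_limit :: "real set \<Rightarrow> (real \<times> nat) filter \<Rightarrow> bool" where
  "joint_limit D F \<longleftrightarrow>
     (\<forall>\<^sub>F p in F. fst p \<in> D) \<and>
     filterlim fst at_top F \<and> filterlim snd at_top F \<and>
     (\<lambda>(\<delta>, t). \<delta>) \<in> o[F](\<lambda>(\<delta>, t). real t)"

text \<open>
  Convergence along a filter, where the underlying probability space may vary with the index.
\<close>

definition conv_in_prob ::
  "'i filter \<Rightarrow> ('i \<Rightarrow> 'a measure) \<Rightarrow> ('i \<Rightarrow> 'a \<Rightarrow> real) \<Rightarrow> real \<Rightarrow> bool" where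
  "conv_in_prob F M Y c \<longleftrightarrow>
     (\<forall>\<^sub>F i in F. Y i \<in> borel_measurable (M i)) \<and>
     (\<forall>\<epsilon>>0. ((\<lambda>i. measure (M i) {\<omega> \<in> space (M i). \<bar>Y i \<omega> - c\<bar> > \<epsilon>}) \<longlongrightarrow> 0) F)"

definition conv_in_distr ::
  "'i filter \<Rightarrow> ('i \<Rightarrow> 'a measure) \<Rightarrow> ('i \<Rightarrow> 'a \<Rightarrow> real) \<Rightarrow> real measure \<Rightarrow> bool" where
  "conv_in_distr F M Y \<nu> \<longleftrightarrow>
     (\<forall>\<^sub>F i in F. Y i \<in> borel_measurable (M i)) \<and>
     (\<forall>x. isCont (cdf \<nu>) x \<longrightarrow> ((\<lambda>i. cdf (distr (M i) borel (Y i)) x) \<longlongrightarrow> cdf \<nu> x) F)"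

lemma conv_in_distr_sequentially_iff:
  "conv_in_distr sequentially M Y \<nu> \<longleftrightarrow>
     (\<forall>\<^sub>F n in sequentially. Y n \<in> borel_measurable (M n)) \<and>
     weak_conv_m (\<lambda>n. distr (M n) borel (Y n)) \<nu>"
  by (simp add: conv_in_distr_def weak_conv_m_def weak_conv_def)

end

theory Submission
  imports Defs
begin

text \<open>
  The age \<open>t - \<tau>(t)\<close> satisfies \<open>P(t - \<tau>(t) \<ge> s) \<le> C \<delta> / s\<close>. By the second moment bound an increment
  exceeds \<open>\<delta> / 2\<close> with a probability bounded below, hence the expected number of renewals in any
  window of length \<open>\<delta> / 2\<close> is bounded. Cut the time before \<open>t - s\<close> into such windows: an age of at least \<open>s\<close>
  requires a renewal in some window followed by an increment longer than its distance to \<open>t\<close>, and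
  Chebyshev's bounds for these increments are summable.

  Thus \<open>t - \<tau>(t)\<close> is \<open>o(t)\<close> in probability, and Kolmogorov's maximal inequality along the walk run backwards
  from \<open>t\<close> shows that \<open>S(\<tau>(t)) - \<mu> \<tau>(t)\<close> and \<open>S(t) - \<mu> t\<close> differ by \<open>o(sqrt t)\<close>, whatever the dependence
  between the two processes. The central limit theorem applies to \<open>S(t)\<close>, whose law does not depend on \<open>\<delta>\<close>, and
  Slutsky's theorem transfers it. Dividing by \<open>t\<close> rather than \<open>\<tau>(t)\<close> adds the bias \<open>\<mu> (t - \<tau>(t)) / t\<close>,
  which is negligible at scale \<open>1 / sqrt t\<close> when \<open>\<delta> = o(sqrt t)\<close>.
\<close>

subsection \<open>Convergence along a filter\<close>

lemma conv_in_probI: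
  assumes "\<forall>\<^sub>F i in F. Y i \<in> borel_measurable (M i)"
    and "\<And>\<eta> e. \<eta> > 0 \<Longrightarrow> e > 0 \<Longrightarrow>
      \<forall>\<^sub>F i in F. measure (M i) {\<omega> \<in> space (M i). \<bar>Y i \<omega> - c\<bar> > \<eta>} \<le> e"
  shows "conv_in_prob F M Y c"
  unfolding conv_in_prob_def
proof (intro conjI allI impI assms(1))
  fix \<eta> :: real assume "\<eta> > 0"
  show "((\<lambda>i. measure (M i) {\<omega> \<in> space (M i). \<bar>Y i \<omega> - c\<bar> > \<eta>}) \<longlongrightarrow> 0) F"
  proof (rule tendstoI)
    fix e :: real assume "e > 0"
    then have "e / 2 > 0" by simp
    from assms(2)[OF \<open>\<eta> > 0\<close> this]
    show "\<forall>\<^sub>F i in F. dist (measure (M i) {\<omega> \<in> space (M i). \<bar>Y i \<omega> - c\<bar> > \<eta>}) 0 < e"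
      by eventually_elim (use \<open>e > 0\<close> in auto)
  qed
qed

lemma conv_in_probD:
  assumes "conv_in_prob F M Y c" "\<eta> > 0" "e > 0"
  shows "\<forall>\<^sub>F i in F. measure (M i) {\<omega> \<in> space (M i). \<bar>Y i \<omega> - c\<bar> > \<eta>} \<le> e"
proof -
  have "((\<lambda>i. measure (M i) {\<omega> \<in> space (M i). \<bar>Y i \<omega> - c\<bar> > \<eta>}) \<longlongrightarrow> 0) F"
    using assms by (simp add: conv_in_prob_def)
  from order_tendstoD(2)[OF this \<open>e > 0\<close>] show ?thesis
    by eventually_elim simp
qed

lemma conv_in_prob_measurable:
  "conv_in_prob F M Y c \<Longrightarrow> \<forall>\<^sub>F i in F. Y i \<in> borel_measurable (M i)"
  by (simp add: conv_in_prob_def)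

text \<open>Compares deviations from two possibly different limits, so that consistency of an
  estimator follows once its error is written as a sequence converging to 0.\<close>

lemma conv_in_prob_cong:
  assumes "\<forall>\<^sub>F i in F. \<forall>\<omega>\<in>space (M i). Y i \<omega> - c = Z i \<omega> - d"
    and "conv_in_prob F M Z d"
  shows "conv_in_prob F M Y c"
proof (rule conv_in_probI)
  show "\<forall>\<^sub>F i in F. Y i \<in> borel_measurable (M i)"
    using assms(1) conv_in_prob_measurable[OF assms(2)]
  proof eventually_elim
    case (elim i)
    have "(\<lambda>\<omega>. Z i \<omega> - d + c) \<in> borel_measurable (M i)" using elim(2) by measurable
    then show ?case by (rule measurable_cong[THEN iffD1, rotated]) (use elim(1) in force)
  qed
  fix \<eta> e :: real assume "\<eta> > 0" "e > 0"
  from conv_in_probD[OF assms(2) this] assms(1)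
  show "\<forall>\<^sub>F i in F. measure (M i) {\<omega> \<in> space (M i). \<bar>Y i \<omega> - c\<bar> > \<eta>} \<le> e"
  proof eventually_elim
    case (elim i)
    have "{\<omega> \<in> space (M i). \<bar>Y i \<omega> - c\<bar> > \<eta>} = {\<omega> \<in> space (M i). \<bar>Z i \<omega> - d\<bar> > \<eta>}"
      using elim(2) by auto
    then show ?case using elim(1) by simp
  qed
qed

text \<open>Tightness along a filter. The bound \<open>K\<close> is fixed before the eventual set of
  indices, so it is uniform over all late indices while nothing is asked of early ones.\<close>

definition bounded_in_prob ::
  "'i filter \<Rightarrow> ('i \<Rightarrow> 'a measure) \<Rightarrow> ('i \<Rightarrow> 'a \<Rightarrow> real) \<Rightarrow> bool" where
  "bounded_in_prob F M Y \<longleftrightarrow>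
     (\<forall>\<^sub>F i in F. Y i \<in> borel_measurable (M i)) \<and>
     (\<forall>e>0. \<exists>K>0. \<forall>\<^sub>F i in F. measure (M i) {\<omega> \<in> space (M i). \<bar>Y i \<omega>\<bar> > K} \<le> e)"

text \<open>An inclusion of events replaces a pointwise bound. This matters for error terms of
  uncontrolled size that are nonzero only on an unlikely event, such as \<open>default_error\<close>
  below.\<close>

lemma conv_in_prob_mono:
  assumes P: "\<forall>\<^sub>F i in F. prob_space (M i)"
    and Z: "\<forall>\<^sub>F i in F. Z i \<in> borel_measurable (M i)"
    and Y: "conv_in_prob F M Y 0"
    and sub: "\<And>\<eta>. \<eta> > 0 \<Longrightarrow> \<exists>\<epsilon>>0. \<forall>\<^sub>F i in F. \<forall>\<omega>\<in>space (M i). \<bar>Z i \<omega>\<bar> > \<eta> \<longrightarrow> \<bar>Y i \<omega>\<bar> > \<epsilon>"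
  shows "conv_in_prob F M Z 0"
proof (rule conv_in_probI[OF Z])
  fix \<eta> e :: real assume "\<eta> > 0" "e > 0"
  obtain \<epsilon> where "\<epsilon> > 0" and
    s: "\<forall>\<^sub>F i in F. \<forall>\<omega>\<in>space (M i). \<bar>Z i \<omega>\<bar> > \<eta> \<longrightarrow> \<bar>Y i \<omega>\<bar> > \<epsilon>"
    using sub[OF \<open>\<eta> > 0\<close>] by blast
  from s conv_in_probD[OF Y \<open>\<epsilon> > 0\<close> \<open>e > 0\<close>] P conv_in_prob_measurable[OF Y]
  show "\<forall>\<^sub>F i in F. measure (M i) {\<omega> \<in> space (M i). \<bar>Z i \<omega> - 0\<bar> > \<eta>} \<le> e"
  proof eventually_elim
    case (elim i)
    interpret prob_space "M i" by fact
    note [measurable] = elim(4)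
    have "measure (M i) {\<omega> \<in> space (M i). \<bar>Z i \<omega> - 0\<bar> > \<eta>}
        \<le> measure (M i) {\<omega> \<in> space (M i). \<bar>Y i \<omega> - 0\<bar> > \<epsilon>}"
      using elim(1) by (intro finite_measure_mono) auto
    then show ?case using elim(2) by simp
  qed
qed

lemma conv_in_prob_add:
  assumes P: "\<forall>\<^sub>F i in F. prob_space (M i)"
    and Y: "conv_in_prob F M Y a" and Z: "conv_in_prob F M Z b"
  shows "conv_in_prob F M (\<lambda>i \<omega>. Y i \<omega> + Z i \<omega>) (a + b)"
proof (rule conv_in_probI)
  show "\<forall>\<^sub>F i in F. (\<lambda>\<omega>. Y i \<omega> + Z i \<omega>) \<in> borel_measurable (M i)"
    using Y[THEN conv_in_prob_measurable] Z[THEN conv_in_prob_measurable]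
    by eventually_elim measurable
  fix \<eta> e :: real assume "\<eta> > 0" "e > 0"
  then have h: "\<eta> / 2 > 0" "e / 2 > 0" by auto
  from conv_in_probD[OF Y h] conv_in_probD[OF Z h] P
    Y[THEN conv_in_prob_measurable] Z[THEN conv_in_prob_measurable]
  show "\<forall>\<^sub>F i in F. measure (M i) {\<omega> \<in> space (M i). \<bar>Y i \<omega> + Z i \<omega> - (a + b)\<bar> > \<eta>} \<le> e"
  proof eventually_elim
    case (elim i)
    interpret prob_space "M i" by fact
    note [measurable] = elim(4,5)
    have "measure (M i) {\<omega> \<in> space (M i). \<bar>Y i \<omega> + Z i \<omega> - (a + b)\<bar> > \<eta>}
        \<le> measure (M i) ({\<omega> \<in> space (M i). \<bar>Y i \<omega> - a\<bar> > \<eta> / 2} \<union>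
                         {\<omega> \<in> space (M i). \<bar>Z i \<omega> - b\<bar> > \<eta> / 2})"
      by (intro finite_measure_mono) (auto simp: abs_if field_simps split: if_splits)
    also have "\<dots> \<le> measure (M i) {\<omega> \<in> space (M i). \<bar>Y i \<omega> - a\<bar> > \<eta> / 2} +
                    measure (M i) {\<omega> \<in> space (M i). \<bar>Z i \<omega> - b\<bar> > \<eta> / 2}"
      by (intro measure_Un_le) measurable
    finally show ?case using elim(1,2) by simp
  qed
qed

text \<open>Where \<open>Y\<close> is at most \<open>K\<close> in absolute value, a product above
  \<open>\<eta>\<close> forces \<open>Z\<close> above \<open>\<eta> / K\<close>; both exceptional
  events get probability at most \<open>e / 2\<close>.\<close>

lemma conv_in_prob_mult_bounded:
  assumes P: "\<forall>\<^sub>F i in F. prob_space (M i)"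
    and Y: "bounded_in_prob F M Y" and Z: "conv_in_prob F M Z 0"
  shows "conv_in_prob F M (\<lambda>i \<omega>. Y i \<omega> * Z i \<omega>) 0"
proof (rule conv_in_probI)
  have Ym: "\<forall>\<^sub>F i in F. Y i \<in> borel_measurable (M i)"
    using Y by (simp add: bounded_in_prob_def)
  show "\<forall>\<^sub>F i in F. (\<lambda>\<omega>. Y i \<omega> * Z i \<omega>) \<in> borel_measurable (M i)"
    using Ym Z[THEN conv_in_prob_measurable] by eventually_elim measurable
  fix \<eta> e :: real assume "\<eta> > 0" "e > 0"
  then have "e / 2 > 0" by simp
  with Y obtain K where "K > 0"
    and K: "\<forall>\<^sub>F i in F. measure (M i) {\<omega> \<in> space (M i). \<bar>Y i \<omega>\<bar> > K} \<le> e / 2"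
    unfolding bounded_in_prob_def by blast
  have "\<eta> / K > 0" using \<open>K > 0\<close> \<open>\<eta> > 0\<close> by simp
  from K conv_in_probD[OF Z this \<open>e / 2 > 0\<close>] P Ym Z[THEN conv_in_prob_measurable]
  show "\<forall>\<^sub>F i in F. measure (M i) {\<omega> \<in> space (M i). \<bar>Y i \<omega> * Z i \<omega> - 0\<bar> > \<eta>} \<le> e"
  proof eventually_elim
    case (elim i)
    interpret prob_space "M i" by fact
    note [measurable] = elim(4,5)
    have "\<bar>Y i \<omega>\<bar> > K \<or> \<bar>Z i \<omega>\<bar> > \<eta> / K" if "\<bar>Y i \<omega> * Z i \<omega>\<bar> > \<eta>" for \<omega>
    proof (rule ccontr)
      assume "\<not> ?thesis"
      then have "\<bar>Y i \<omega>\<bar> * \<bar>Z i \<omega>\<bar> \<le> K * (\<eta> / K)"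
        using \<open>K > 0\<close> by (intro mult_mono) auto
      with that \<open>K > 0\<close> show False by (simp add: abs_mult)
    qed
    then have "measure (M i) {\<omega> \<in> space (M i). \<bar>Y i \<omega> * Z i \<omega> - 0\<bar> > \<eta>}
        \<le> measure (M i) ({\<omega> \<in> space (M i). \<bar>Y i \<omega>\<bar> > K} \<union>
                         {\<omega> \<in> space (M i). \<bar>Z i \<omega> - 0\<bar> > \<eta> / K})"
      by (intro finite_measure_mono) auto
    also have "\<dots> \<le> measure (M i) {\<omega> \<in> space (M i). \<bar>Y i \<omega>\<bar> > K} +
                    measure (M i) {\<omega> \<in> space (M i). \<bar>Z i \<omega> - 0\<bar> > \<eta> / K}"
      by (intro measure_Un_le) measurable
    finally show ?case using elim(1,2) by simp
  qed
qed

lemma conv_in_prob_imp_bounded: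
  assumes P: "\<forall>\<^sub>F i in F. prob_space (M i)" and Y: "conv_in_prob F M Y c"
  shows "bounded_in_prob F M Y"
  unfolding bounded_in_prob_def
proof (intro conjI allI impI conv_in_prob_measurable[OF Y])
  fix e :: real assume "e > 0"
  from conv_in_probD[OF Y zero_less_one this] P conv_in_prob_measurable[OF Y]
  have "\<forall>\<^sub>F i in F. measure (M i) {\<omega> \<in> space (M i). \<bar>Y i \<omega>\<bar> > \<bar>c\<bar> + 1} \<le> e"
  proof eventually_elim
    case (elim i)
    interpret prob_space "M i" by fact
    note [measurable] = elim(3)
    have "measure (M i) {\<omega> \<in> space (M i). \<bar>Y i \<omega>\<bar> > \<bar>c\<bar> + 1}
        \<le> measure (M i) {\<omega> \<in> space (M i). \<bar>Y i \<omega> - c\<bar> > 1}"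
      by (intro finite_measure_mono) auto
    then show ?case using elim(1) by simp
  qed
  then show "\<exists>K>0. \<forall>\<^sub>F i in F. measure (M i) {\<omega> \<in> space (M i). \<bar>Y i \<omega>\<bar> > K} \<le> e"
    by (intro exI[of _ "\<bar>c\<bar> + 1"]) auto
qed

lemma bounded_in_prob_add:
  assumes P: "\<forall>\<^sub>F i in F. prob_space (M i)"
    and Y: "bounded_in_prob F M Y" and Z: "bounded_in_prob F M Z"
  shows "bounded_in_prob F M (\<lambda>i \<omega>. Y i \<omega> + Z i \<omega>)"
  unfolding bounded_in_prob_def
proof (intro conjI allI impI)
  have m: "\<forall>\<^sub>F i in F. Y i \<in> borel_measurable (M i)" "\<forall>\<^sub>F i in F. Z i \<in> borel_measurable (M i)"
    using Y Z by (simp_all add: bounded_in_prob_def)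
  show "\<forall>\<^sub>F i in F. (\<lambda>\<omega>. Y i \<omega> + Z i \<omega>) \<in> borel_measurable (M i)"
    using m by eventually_elim measurable
  fix e :: real assume "e > 0"
  then have h: "e / 2 > 0" by simp
  obtain K where K: "K > 0" "\<forall>\<^sub>F i in F. measure (M i) {\<omega> \<in> space (M i). \<bar>Y i \<omega>\<bar> > K} \<le> e / 2"
    using Y h unfolding bounded_in_prob_def by blast
  obtain L where L: "L > 0" "\<forall>\<^sub>F i in F. measure (M i) {\<omega> \<in> space (M i). \<bar>Z i \<omega>\<bar> > L} \<le> e / 2"
    using Z h unfolding bounded_in_prob_def by blast
  from K(2) L(2) P m
  have "\<forall>\<^sub>F i in F. measure (M i) {\<omega> \<in> space (M i). \<bar>Y i \<omega> + Z i \<omega>\<bar> > K + L} \<le> e"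
  proof eventually_elim
    case (elim i)
    interpret prob_space "M i" by fact
    note [measurable] = elim(4,5)
    have "measure (M i) {\<omega> \<in> space (M i). \<bar>Y i \<omega> + Z i \<omega>\<bar> > K + L}
        \<le> measure (M i) ({\<omega> \<in> space (M i). \<bar>Y i \<omega>\<bar> > K} \<union> {\<omega> \<in> space (M i). \<bar>Z i \<omega>\<bar> > L})"
      by (intro finite_measure_mono) auto
    also have "\<dots> \<le> measure (M i) {\<omega> \<in> space (M i). \<bar>Y i \<omega>\<bar> > K} +
                    measure (M i) {\<omega> \<in> space (M i). \<bar>Z i \<omega>\<bar> > L}"
      by (intro measure_Un_le) measurable
    finally show ?case using elim(1,2) by simp
  qed
  then show "\<exists>K>0. \<forall>\<^sub>F i in F. measure (M i) {\<omega> \<in> space (M i). \<bar>Y i \<omega> + Z i \<omega>\<bar> > K} \<le> e"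
    using K(1) L(1) by (intro exI[of _ "K + L"]) auto
qed

lemma conv_in_prob_const:
  assumes P: "\<forall>\<^sub>F i in F. prob_space (M i)" and "(a \<longlongrightarrow> c) F"
  shows "conv_in_prob F M (\<lambda>i \<omega>. a i) c"
proof (rule conv_in_probI)
  fix \<eta> e :: real assume "\<eta> > 0" "e > 0"
  from tendstoD[OF assms(2) \<open>\<eta> > 0\<close>]
  show "\<forall>\<^sub>F i in F. measure (M i) {\<omega> \<in> space (M i). \<bar>a i - c\<bar> > \<eta>} \<le> e"
    by eventually_elim (use \<open>e > 0\<close> in \<open>auto simp: dist_real_def\<close>)
qed auto

lemma conv_in_prob_cmult:
  assumes P: "\<forall>\<^sub>F i in F. prob_space (M i)" and Z: "conv_in_prob F M Z 0"
  shows "conv_in_prob F M (\<lambda>i \<omega>. c * Z i \<omega>) 0"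
  by (rule conv_in_prob_mult_bounded[OF P conv_in_prob_imp_bounded[OF P conv_in_prob_const[OF P tendsto_const]] Z])

lemma conv_in_distr_cong:
  assumes "\<forall>\<^sub>F i in F. \<forall>\<omega>\<in>space (M i). Y i \<omega> = Z i \<omega>"
    and "conv_in_distr F M Z \<nu>"
  shows "conv_in_distr F M Y \<nu>"
  unfolding conv_in_distr_def
proof (intro conjI allI impI)
  have "\<forall>\<^sub>F i in F. Z i \<in> borel_measurable (M i)"
    using assms(2) by (simp add: conv_in_distr_def)
  with assms(1) show "\<forall>\<^sub>F i in F. Y i \<in> borel_measurable (M i)"
  proof eventually_elim
    case (elim i)
    show ?case by (rule measurable_cong[THEN iffD2, OF _ elim(2)]) (use elim(1) in auto)
  qed
  fix x assume "isCont (cdf \<nu>) x"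
  then have lim: "((\<lambda>i. cdf (distr (M i) borel (Z i)) x) \<longlongrightarrow> cdf \<nu> x) F"
    using assms(2) by (simp add: conv_in_distr_def)
  have "\<forall>\<^sub>F i in F. cdf (distr (M i) borel (Z i)) x = cdf (distr (M i) borel (Y i)) x"
    using assms(1)
  proof eventually_elim
    case (elim i)
    have "distr (M i) borel (Z i) = distr (M i) borel (Y i)"
      using elim by (intro distr_cong) auto
    then show ?case by simp
  qed
  then show "((\<lambda>i. cdf (distr (M i) borel (Y i)) x) \<longlongrightarrow> cdf \<nu> x) F"
    by (rule Lim_transform_eventually[OF lim])
qed

text \<open>Unless \<open>Z\<close> exceeds \<open>h\<close> in absolute value, the event that
  \<open>Y + Z\<close> is at most \<open>x\<close> lies between the events that \<open>Y\<close> is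
  at most \<open>x - h\<close> and at most \<open>x + h\<close>. Continuity of the limit everywhere
  makes every shifted point admissible.\<close>

lemma Slutsky_add:
  assumes P: "\<forall>\<^sub>F i in F. prob_space (M i)"
    and Y: "conv_in_distr F M Y \<nu>" and Z: "conv_in_prob F M Z 0"
    and cont: "\<And>x. isCont (cdf \<nu>) x"
  shows "conv_in_distr F M (\<lambda>i \<omega>. Y i \<omega> + Z i \<omega>) \<nu>"
  unfolding conv_in_distr_def
proof (intro conjI allI impI)
  have Ym: "\<forall>\<^sub>F i in F. Y i \<in> borel_measurable (M i)"
    using Y by (simp add: conv_in_distr_def)
  note Zm = conv_in_prob_measurable[OF Z]
  show "\<forall>\<^sub>F i in F. (\<lambda>\<omega>. Y i \<omega> + Z i \<omega>) \<in> borel_measurable (M i)"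
    using Ym Zm by eventually_elim measurable
  have Yt: "((\<lambda>i. cdf (distr (M i) borel (Y i)) x) \<longlongrightarrow> cdf \<nu> x) F" for x
    using Y cont by (simp add: conv_in_distr_def)
  fix x
  show "((\<lambda>i. cdf (distr (M i) borel (\<lambda>\<omega>. Y i \<omega> + Z i \<omega>)) x) \<longlongrightarrow> cdf \<nu> x) F"
  proof (rule tendstoI)
    fix e :: real assume "e > 0"
    then have e3: "e / 3 > 0" by simp
    obtain d where "d > 0" and d: "\<And>y. dist y x < d \<Longrightarrow> dist (cdf \<nu> y) (cdf \<nu> x) < e / 3"
      using cont[of x, unfolded continuous_at_eps_delta, rule_format, OF e3] by blast
    \<comment> \<open>Half of \<open>d\<close> puts \<open>x - h\<close> and \<open>x + h\<close>
      strictly inside the continuity neighbourhood. The three errors of size \<open>e / 3\<close>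
      come from continuity, from convergence of \<open>Y\<close>, and from the event that
      \<open>Z\<close> is large.\<close>
    define h where "h = d / 2"
    have h: "h > 0" "h < d" using \<open>d > 0\<close> by (auto simp: h_def)
    from tendstoD[OF Yt[of "x + h"] e3] tendstoD[OF Yt[of "x - h"] e3]
      conv_in_probD[OF Z h(1) e3] P Ym Zm
    show "\<forall>\<^sub>F i in F. dist (cdf (distr (M i) borel (\<lambda>\<omega>. Y i \<omega> + Z i \<omega>)) x) (cdf \<nu> x) < e"
    proof eventually_elim
      case (elim i)
      interpret prob_space "M i" by fact
      note [measurable] = elim(5,6)
      have c: "cdf (distr (M i) borel f) y = prob {\<omega> \<in> space (M i). f \<omega> \<le> y}"
        if "f \<in> borel_measurable (M i)" for f y
        using that by (simp add: cdf_def measure_distr vimage_def Int_def conj_commute)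
      let ?B = "{\<omega> \<in> space (M i). \<bar>Z i \<omega> - 0\<bar> > h}"
      have "prob {\<omega> \<in> space (M i). Y i \<omega> + Z i \<omega> \<le> x}
          \<le> prob ({\<omega> \<in> space (M i). Y i \<omega> \<le> x + h} \<union> ?B)"
        by (intro finite_measure_mono) auto
      also have "\<dots> \<le> prob {\<omega> \<in> space (M i). Y i \<omega> \<le> x + h} + prob ?B"
        by (intro measure_Un_le) measurable
      finally have 1: "prob {\<omega> \<in> space (M i). Y i \<omega> + Z i \<omega> \<le> x} \<le> \<dots>" .
      have "prob {\<omega> \<in> space (M i). Y i \<omega> \<le> x - h}
          \<le> prob ({\<omega> \<in> space (M i). Y i \<omega> + Z i \<omega> \<le> x} \<union> ?B)"
        by (intro finite_measure_mono) auto
      also have "\<dots> \<le> prob {\<omega> \<in> space (M i). Y i \<omega> + Z i \<omega> \<le> x} + prob ?B"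
        by (intro measure_Un_le) measurable
      finally have 2: "prob {\<omega> \<in> space (M i). Y i \<omega> \<le> x - h} \<le> \<dots>" .
      have "dist (cdf \<nu> (x + h)) (cdf \<nu> x) < e / 3" "dist (cdf \<nu> (x - h)) (cdf \<nu> x) < e / 3"
        using h by (rule_tac d; simp add: dist_real_def)+
      moreover have "dist (prob {\<omega> \<in> space (M i). Y i \<omega> \<le> x + h}) (cdf \<nu> (x + h)) < e / 3"
        "dist (prob {\<omega> \<in> space (M i). Y i \<omega> \<le> x - h}) (cdf \<nu> (x - h)) < e / 3"
        using elim(1,2) by (simp_all add: c)
      ultimately have "\<bar>prob {\<omega> \<in> space (M i). Y i \<omega> + Z i \<omega> \<le> x} - cdf \<nu> x\<bar> < e"
        using 1 2 elim(3) unfolding dist_real_def by linarith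
      then show ?case by (simp add: c dist_real_def)
    qed
  qed
qed

lemma isCont_cdf_std_normal: "isCont (cdf std_normal_distribution) x"
proof -
  interpret real_distribution std_normal_distribution by (rule real_dist_normal_dist)
  have "emeasure std_normal_distribution {x} = 0"
    by (simp add: emeasure_density)
  then show ?thesis by (simp add: isCont_cdf measure_def)
qed

subsection \<open>Kolmogorov's maximal inequality\<close>

text \<open>Serves two changes of index for the summands: the shift from indices starting at 1 to
  indices starting at 0, and the reversal of time.\<close>

lemma (in prob_space) indep_vars_reindex:
  assumes "indep_vars N X (f ` I)" "inj_on f I"
  shows "indep_vars (\<lambda>i. N (f i)) (\<lambda>i. X (f i)) I"
  using assms(1) unfolding indep_vars_def2 indep_sets_def
proof (intro conjI ballI allI impI; (elim conjE)?)
  fix J A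
  assume J: "J \<subseteq> I" "J \<noteq> {}" "finite J"
    and A: "A \<in> (\<Pi> j\<in>J. {X (f j) -` A \<inter> space M |A. A \<in> sets (N (f j))})"
    and *: "\<forall>K\<subseteq>f ` I. K \<noteq> {} \<longrightarrow> finite K \<longrightarrow>
      (\<forall>A\<in>\<Pi> j\<in>K. {X j -` A \<inter> space M |A. A \<in> sets (N j)}. prob (\<Inter> (A ` K)) = (\<Prod>j\<in>K. prob (A j)))"
  have inj: "inj_on f J" using assms(2) J(1) by (rule inj_on_subset)
  \<comment> \<open>The events indexed by \<open>J\<close> are transported to the image of
    \<open>J\<close>, where the product formula is available.\<close>
  define B where "B = A \<circ> the_inv_into J f"
  have Bf: "B (f j) = A j" if "j \<in> J" for j
    using that inj by (simp add: B_def the_inv_into_f_f)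
  have "prob (\<Inter> (B ` f ` J)) = (\<Prod>j\<in>f ` J. prob (B j))"
    using J A Bf by (intro *[rule_format]) (auto simp: Pi_iff)
  also have "B ` f ` J = A ` J" using Bf by (auto simp: image_image)
  also have "(\<Prod>j\<in>f ` J. prob (B j)) = (\<Prod>j\<in>J. prob (A j))"
    using inj Bf by (simp add: prod.reindex)
  finally show "prob (\<Inter> (A ` J)) = (\<Prod>j\<in>J. prob (A j))" .
qed auto

text \<open>The walk freezes as soon as its absolute value reaches \<open>a\<close>. The recursion
  avoids a stopping time: whether step \<open>n\<close> is taken is read off from the walk at
  \<open>n\<close>, a function of the earlier increments.\<close>

primrec stopped_walk :: "real \<Rightarrow> (nat \<Rightarrow> real) \<Rightarrow> nat \<Rightarrow> real" where
  "stopped_walk a y 0 = 0"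
| "stopped_walk a y (Suc n) =
     stopped_walk a y n + (if \<bar>stopped_walk a y n\<bar> < a then y n else 0)"

text \<open>A frozen walk keeps an absolute value of at least \<open>a\<close>, so a walk still
  below \<open>a\<close> has taken every step so far.\<close>

lemma stopped_walk_eq_sum:
  assumes "\<bar>stopped_walk a y n\<bar> < a"
  shows "stopped_walk a y n = (\<Sum>i<n. y i)"
  using assms by (induction n) (auto split: if_splits)

text \<open>Reduces a maximum over all times to the terminal value: at time \<open>m\<close> the
  stopped walk has either frozen already or still agrees with the free walk, which is now outside,
  and it never moves back.\<close>

lemma stopped_walk_exit:
  assumes "m \<le> n" "\<bar>\<Sum>i<m. y i\<bar> \<ge> a"
  shows "\<bar>stopped_walk a y n\<bar> \<ge> a"
  using assms(1)
proof (induction rule: dec_induct)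
  case base
  show ?case using stopped_walk_eq_sum[of a y m] assms(2) by linarith
qed auto

lemma measurable_stopped_walk:
  assumes "n \<le> m"
  shows "(\<lambda>y. stopped_walk a y n) \<in> borel_measurable (PiM {..<m} (\<lambda>_. borel))"
  using assms
proof (induction n)
  case (Suc n)
  have [measurable]: "(\<lambda>y. stopped_walk a y n) \<in> borel_measurable (PiM {..<m} (\<lambda>_. borel))"
    "(\<lambda>y. y n) \<in> borel_measurable (PiM {..<m} (\<lambda>_. borel))"
    using Suc by auto
  show ?case by simp
qed auto

lemma stopped_walk_cong:
  assumes "\<And>i. i < n \<Longrightarrow> y i = z i"
  shows "stopped_walk a y n = stopped_walk a z n"
  using assms by (induction n) auto

text \<open>
  Whether the walk is still moving before step \<^term>\<open>n\<close> is decided by the earlier increments, so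
  the increments of the stopped walk remain orthogonal.
\<close>

lemma (in prob_space) second_moment_stopped_walk:
  assumes ind: "indep_vars (\<lambda>_. borel) Y {..<m}"
    and int: "\<And>i. i < m \<Longrightarrow> integrable M (\<lambda>\<omega>. (Y i \<omega>)\<^sup>2)"
    and mean: "\<And>i. i < m \<Longrightarrow> expectation (Y i) = 0"
    and "n \<le> m"
  shows "integrable M (\<lambda>\<omega>. (stopped_walk a (\<lambda>i. Y i \<omega>) n)\<^sup>2) \<and>
    expectation (\<lambda>\<omega>. (stopped_walk a (\<lambda>i. Y i \<omega>) n)\<^sup>2) \<le> (\<Sum>i<n. expectation (\<lambda>\<omega>. (Y i \<omega>)\<^sup>2))"
  using \<open>n \<le> m\<close>
proof (induction n)
  case 0
  then show ?case by simp
next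
  case (Suc n)
  then have "n < m" by simp
  let ?W = "\<lambda>\<omega>. stopped_walk a (\<lambda>i. Y i \<omega>) n"
  \<comment> \<open>Squaring the walk after step \<open>n\<close> produces the cross term
    \<open>2 * (Y n \<omega> * g (?W \<omega>))\<close> and the quadratic term
    \<open>(Y n \<omega>)\<^sup>2 * h (?W \<omega>)\<close>. The truncation bounds \<open>g\<close>
    by \<open>\<bar>a\<bar>\<close>, which gives integrability at once, and \<open>h\<close> by
    1.\<close>
  define g where "g w = (if \<bar>w\<bar> < a then w else 0)" for w :: real
  define h where "h w = (if \<bar>w\<bar> < a then 1 else 0 :: real)" for w :: real
  have [measurable]: "g \<in> borel_measurable borel" "h \<in> borel_measurable borel"
    unfolding g_def h_def by measurable
  have Ym [measurable]: "Y i \<in> borel_measurable M" if "i < m" for i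
    using ind that by (auto simp: indep_vars_def2)
  have [measurable]: "Y n \<in> borel_measurable M" using Ym \<open>n < m\<close> by simp
  \<comment> \<open>Independence of the coordinate blocks \<open>{n}\<close> and
    \<open>{..<n}\<close> passes to \<open>Y n\<close> and the stopped walk, a measurable function
    of the second block.\<close>
  have "indep_var (PiM {n} (\<lambda>_. borel)) (\<lambda>\<omega>. restrict (\<lambda>i. Y i \<omega>) {n})
     (PiM {..<n} (\<lambda>_. borel)) (\<lambda>\<omega>. restrict (\<lambda>i. Y i \<omega>) {..<n})"
    using \<open>n < m\<close> by (intro indep_var_restrict[OF ind]) auto
  then have "indep_var borel ((\<lambda>y. y n) \<circ> (\<lambda>\<omega>. restrict (\<lambda>i. Y i \<omega>) {n}))
      borel ((\<lambda>y. stopped_walk a y n) \<circ> (\<lambda>\<omega>. restrict (\<lambda>i. Y i \<omega>) {..<n}))"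
    by (rule indep_var_compose) (auto intro: measurable_stopped_walk)
  moreover have "(\<lambda>y. stopped_walk a y n) \<circ> (\<lambda>\<omega>. restrict (\<lambda>i. Y i \<omega>) {..<n}) = ?W"
    by (auto simp: fun_eq_iff intro!: stopped_walk_cong)
  ultimately have ind': "indep_var borel (Y n) borel ?W"
    by (simp add: comp_def)
  have Wm [measurable]: "?W \<in> borel_measurable M" using ind' by (rule indep_var_rv2)
  have indg: "indep_var borel (Y n) borel (\<lambda>\<omega>. g (?W \<omega>))"
    using indep_var_compose[OF ind', of id borel g borel] by (simp add: comp_def)
  have intW: "integrable M (\<lambda>\<omega>. (?W \<omega>)\<^sup>2)"
    and leW: "expectation (\<lambda>\<omega>. (?W \<omega>)\<^sup>2) \<le> (\<Sum>i<n. expectation (\<lambda>\<omega>. (Y i \<omega>)\<^sup>2))"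
    using Suc by auto
  have intY: "integrable M (Y n)"
    by (rule square_integrable_imp_integrable[OF _ int[OF \<open>n < m\<close>]]) simp
  have intg: "integrable M (\<lambda>\<omega>. g (?W \<omega>))"
    by (rule integrable_const_bound[where B = "\<bar>a\<bar>"]) (auto simp: g_def)
  have inth: "integrable M (\<lambda>\<omega>. (Y n \<omega>)\<^sup>2 * h (?W \<omega>))"
    by (rule Bochner_Integration.integrable_bound[OF int[OF \<open>n < m\<close>]]) (auto simp: h_def)
  have intYg: "integrable M (\<lambda>\<omega>. Y n \<omega> * g (?W \<omega>))"
    by (rule indep_var_integrable[OF indg intY intg])
  have eYg: "expectation (\<lambda>\<omega>. Y n \<omega> * g (?W \<omega>)) = 0"
    using indep_var_lebesgue_integral[OF indg intY intg] mean[OF \<open>n < m\<close>] by simp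
  have eh: "expectation (\<lambda>\<omega>. (Y n \<omega>)\<^sup>2 * h (?W \<omega>)) \<le> expectation (\<lambda>\<omega>. (Y n \<omega>)\<^sup>2)"
    using inth int[OF \<open>n < m\<close>] by (intro integral_mono) (auto simp: h_def)
  have eq: "(\<lambda>\<omega>. (stopped_walk a (\<lambda>i. Y i \<omega>) (Suc n))\<^sup>2) =
      (\<lambda>\<omega>. (?W \<omega>)\<^sup>2 + 2 * (Y n \<omega> * g (?W \<omega>)) + (Y n \<omega>)\<^sup>2 * h (?W \<omega>))"
    by (auto simp: fun_eq_iff g_def h_def power2_sum)
  show ?case unfolding eq using intW intYg inth eYg eh leW by simp
qed

text \<open>If some partial sum reaches \<open>a\<close>, the stopped walk ends with absolute value
  at least \<open>a\<close>. Markov's inequality for its squared terminal value then gives the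
  bound.\<close>

theorem (in prob_space) Kolmogorov_maximal_inequality:
  fixes Y :: "nat \<Rightarrow> 'a \<Rightarrow> real"
  assumes ind: "indep_vars (\<lambda>_. borel) Y {..<m}"
    and int: "\<And>i. i < m \<Longrightarrow> integrable M (\<lambda>\<omega>. (Y i \<omega>)\<^sup>2)"
    and mean: "\<And>i. i < m \<Longrightarrow> expectation (Y i) = 0"
    and "a > 0"
  shows "prob {\<omega> \<in> space M. \<exists>n\<le>m. \<bar>\<Sum>i<n. Y i \<omega>\<bar> \<ge> a} \<le> (\<Sum>i<m. expectation (\<lambda>\<omega>. (Y i \<omega>)\<^sup>2)) / a\<^sup>2"
proof -
  let ?W = "\<lambda>\<omega>. stopped_walk a (\<lambda>i. Y i \<omega>) m"
  have W: "integrable M (\<lambda>\<omega>. (?W \<omega>)\<^sup>2)"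
    "expectation (\<lambda>\<omega>. (?W \<omega>)\<^sup>2) \<le> (\<Sum>i<m. expectation (\<lambda>\<omega>. (Y i \<omega>)\<^sup>2))"
    using second_moment_stopped_walk[OF ind int mean order_refl] by auto
  have [measurable]: "(\<lambda>\<omega>. (?W \<omega>)\<^sup>2) \<in> borel_measurable M" using W(1) by auto
  have "a\<^sup>2 \<le> (?W \<omega>)\<^sup>2" if "\<exists>n\<le>m. \<bar>\<Sum>i<n. Y i \<omega>\<bar> \<ge> a" for \<omega>
    using that stopped_walk_exit[of _ m a] \<open>a > 0\<close> abs_le_square_iff[of a "?W \<omega>"] by auto
  then have "prob {\<omega> \<in> space M. \<exists>n\<le>m. \<bar>\<Sum>i<n. Y i \<omega>\<bar> \<ge> a} \<le> prob {\<omega> \<in> space M. (?W \<omega>)\<^sup>2 \<ge> a\<^sup>2}"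
    by (intro finite_measure_mono) auto
  also have "\<dots> \<le> expectation (\<lambda>\<omega>. (?W \<omega>)\<^sup>2) / a\<^sup>2"
    using W(1) \<open>a > 0\<close> by (intro integral_Markov_inequality_measure[where A = "space M"]) auto
  also have "\<dots> \<le> (\<Sum>i<m. expectation (\<lambda>\<omega>. (Y i \<omega>)\<^sup>2)) / a\<^sup>2"
    using W(2) by (intro divide_right_mono) auto
  finally show ?thesis .
qed

subsection \<open>Sums of i.i.d. variables with a random index\<close>

text \<open>The common law \<nu> is a parameter, so that instances on different probability spaces
  can share it.\<close>

locale iid_sequence = prob_space +
  fixes \<nu> :: "real measure" and X :: "nat \<Rightarrow> 'a \<Rightarrow> real" and \<mu> \<sigma> :: real
  assumes iid_X: "iid M borel \<nu> {1..} X"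
    and square_integrable_X: "i \<ge> 1 \<Longrightarrow> integrable M (\<lambda>\<omega>. (X i \<omega>)\<^sup>2)"
    and expectation_X: "i \<ge> 1 \<Longrightarrow> expectation (X i) = \<mu>"
    and variance_X: "i \<ge> 1 \<Longrightarrow> variance (X i) = \<sigma>\<^sup>2"
    and \<sigma>_pos: "\<sigma> > 0"
begin

lemma indep_X: "indep_vars (\<lambda>_. borel) X {1..}"
  using iid_X by (simp add: iid_def)

lemma distr_X: "i \<ge> 1 \<Longrightarrow> distr M borel (X i) = \<nu>"
  using iid_X by (simp add: iid_def)

lemma measurable_X [measurable]: "i \<ge> 1 \<Longrightarrow> X i \<in> borel_measurable M"
  using indep_X by (auto simp: indep_vars_def2)

lemma measurable_partial_sum [measurable]: "partial_sum X n \<in> borel_measurable M"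
  unfolding partial_sum_def[abs_def] by measurable

lemma indep_X_Suc: "indep_vars (\<lambda>_. borel) (\<lambda>i. X (Suc i)) UNIV"
proof -
  have "Suc ` UNIV = {1..}" by (auto simp: image_iff) (metis Suc_le_D)
  then show ?thesis using indep_vars_reindex[of "\<lambda>_. borel" X Suc UNIV] indep_X by simp
qed

lemma partial_sum_eq: "partial_sum X n \<omega> = (\<Sum>i<n. X (Suc i) \<omega>)"
  unfolding partial_sum_def
  by (rule sum.reindex_bij_witness[of _ Suc "\<lambda>i. i - 1"]) auto

text \<open>The right-hand side mentions only \<nu> and \<open>n\<close>. This is what lets a limit
  theorem proved on one space be transferred to a family of spaces.\<close>

lemma distr_partial_sum:
  "distr M borel (partial_sum X n) = distr (PiM {..<n} (\<lambda>_. \<nu>)) borel (\<lambda>x. \<Sum>i<n. x i)"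
proof -
  have sets: "sets (PiM {..<n} (\<lambda>_. \<nu>)) = sets (PiM {..<n} (\<lambda>_. borel))"
    using distr_X[of 1] by (intro sets_PiM_cong) auto
  show ?thesis
  proof (cases "n = 0")
    \<comment> \<open>The product characterization of independence is applied to a nonempty index
      set; for the empty sum both sides are the law of the constant 0.\<close>
    case True
    interpret P: prob_space \<nu> using distr_X[of 1] prob_space_distr[OF measurable_X[of 1]] by simp
    interpret Q: prob_space "PiM {..<n} (\<lambda>_. \<nu>)" by (intro prob_space_PiM P.prob_space_axioms)
    show ?thesis
      using True distr_const[of 0 borel] Q.distr_const[of "0 :: real" borel] by (simp add: partial_sum_eq[abs_def])
  next
    case False
    have "distr M (PiM {..<n} (\<lambda>_. borel)) (\<lambda>\<omega>. \<lambda>i\<in>{..<n}. X (Suc i) \<omega>) = PiM {..<n} (\<lambda>_. \<nu>)"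
      using False indep_vars_iff_distr_eq_PiM'[of "{..<n}" "\<lambda>i. X (Suc i)" "\<lambda>_. borel"]
        indep_vars_subset[OF indep_X_Suc, of "{..<n}"] by (auto simp: distr_X lessThan_empty_iff)
    then have "distr (PiM {..<n} (\<lambda>_. \<nu>)) borel (\<lambda>x. \<Sum>i<n. x i) =
      distr (distr M (PiM {..<n} (\<lambda>_. borel)) (\<lambda>\<omega>. \<lambda>i\<in>{..<n}. X (Suc i) \<omega>)) borel (\<lambda>x. \<Sum>i<n. x i)"
      by simp
    also have "\<dots> = distr M borel ((\<lambda>x. \<Sum>i<n. x i) \<circ> (\<lambda>\<omega>. \<lambda>i\<in>{..<n}. X (Suc i) \<omega>))"
      by (rule distr_distr) measurable
    finally show ?thesis by (simp add: comp_def partial_sum_eq[abs_def])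
  qed
qed

lemma central_limit_partial_sum:
  "weak_conv_m (\<lambda>n. distr M borel (\<lambda>\<omega>. (partial_sum X n \<omega> - real n * \<mu>) / (\<sigma> * sqrt (real n))))
     std_normal_distribution"
proof -
  have "(\<Sum>i<n. X (Suc i) \<omega> - \<mu>) / sqrt (real n * \<sigma>\<^sup>2) =
      (partial_sum X n \<omega> - real n * \<mu>) / (\<sigma> * sqrt (real n))" for n \<omega>
    using \<sigma>_pos by (simp add: partial_sum_eq sum_subtractf real_sqrt_mult mult.commute)
  moreover have "expectation (\<lambda>\<omega>. (X (Suc n) \<omega> - \<mu>)\<^sup>2) = \<sigma>\<^sup>2" for n
    using variance_X[of "Suc n"] by (simp add: expectation_X)
  ultimately show ?thesis
    using central_limit_theorem[OF indep_X_Suc, of \<mu> \<sigma> \<nu>] \<sigma>_pos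
    by (simp add: square_integrable_X expectation_X variance_X distr_X)
qed

lemma integrable_X: "i \<ge> 1 \<Longrightarrow> integrable M (X i)"
  by (rule square_integrable_imp_integrable[OF _ square_integrable_X]) auto

text \<open>Kolmogorov's inequality for the walk that runs backwards from time \<^term>\<open>n\<close>.\<close>

lemma prob_backward_deviation_le:
  assumes "m \<le> n" "a > 0"
  shows "prob {\<omega> \<in> space M. \<exists>r\<le>m.
      \<bar>(partial_sum X n \<omega> - real n * \<mu>) - (partial_sum X (n - r) \<omega> - real (n - r) * \<mu>)\<bar> \<ge> a}
    \<le> real m * \<sigma>\<^sup>2 / a\<^sup>2"
proof -
  \<comment> \<open>Centred summands listed from index \<open>n\<close> downwards. Since
    \<open>m \<le> n\<close>, the first \<open>m\<close> of them have indices at least 1.\<close>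
  define Y where "Y i \<omega> = X (n - i) \<omega> - \<mu>" for i \<omega>
  have sub: "(\<lambda>i. n - i) ` {..<m} \<subseteq> {1..}" using assms(1) by auto
  have inj: "inj_on (\<lambda>i. n - i) {..<m}" using assms(1) by (auto simp: inj_on_def)
  have "indep_vars (\<lambda>_. borel) (\<lambda>i. X (n - i)) {..<m}"
    using indep_vars_reindex[OF indep_vars_subset[OF indep_X sub] inj] by simp
  then have ind: "indep_vars (\<lambda>_. borel) Y {..<m}"
    unfolding Y_def[abs_def] by (rule indep_vars_compose2) auto
  have int: "integrable M (\<lambda>\<omega>. (Y i \<omega>)\<^sup>2)" if "i < m" for i
    using that assms(1) square_integrable_X[of "n - i"] integrable_X[of "n - i"]
    by (auto simp: Y_def power2_diff)
  have mean: "expectation (Y i) = 0" if "i < m" for i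
    using that assms(1) integrable_X[of "n - i"] expectation_X[of "n - i"]
    by (auto simp: Y_def[abs_def] prob_space)
  have var: "expectation (\<lambda>\<omega>. (Y i \<omega>)\<^sup>2) = \<sigma>\<^sup>2" if "i < m" for i
    using that assms(1) variance_X[of "n - i"] expectation_X[of "n - i"] by (auto simp: Y_def)
  have "(partial_sum X n \<omega> - real n * \<mu>) - (partial_sum X (n - r) \<omega> - real (n - r) * \<mu>)
      = (\<Sum>i<r. Y i \<omega>)" if "r \<le> m" for r \<omega>
    using that
  proof (induction r)
    case (Suc r)
    then have "n - r = Suc (n - Suc r)" using assms(1) by simp
    then have "partial_sum X (n - r) \<omega> = partial_sum X (n - Suc r) \<omega> + X (n - r) \<omega>"
      by (simp add: partial_sum_def)
    with Suc assms(1) show ?case by (simp add: Y_def of_nat_diff algebra_simps)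
  qed simp
  then have "prob {\<omega> \<in> space M. \<exists>r\<le>m.
      \<bar>(partial_sum X n \<omega> - real n * \<mu>) - (partial_sum X (n - r) \<omega> - real (n - r) * \<mu>)\<bar> \<ge> a}
    = prob {\<omega> \<in> space M. \<exists>r\<le>m. \<bar>\<Sum>i<r. Y i \<omega>\<bar> \<ge> a}"
    by (intro arg_cong[where f = prob]) auto
  also have "\<dots> \<le> (\<Sum>i<m. expectation (\<lambda>\<omega>. (Y i \<omega>)\<^sup>2)) / a\<^sup>2"
    by (rule Kolmogorov_maximal_inequality[OF ind int mean assms(2)])
  also have "\<dots> = real m * \<sigma>\<^sup>2 / a\<^sup>2" by (simp add: var)
  finally show ?thesis .
qed

text \<open>Chebyshev's inequality, read off from the backward inequality with \<open>m = n\<close>: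
  the witness \<open>r = n\<close> leads back to the empty sum.\<close>

lemma prob_partial_sum_gt_le:
  assumes "a > 0" "n > 0"
  shows "prob {\<omega> \<in> space M. \<bar>(partial_sum X n \<omega> - real n * \<mu>) / (\<sigma> * sqrt (real n))\<bar> > a} \<le> 1 / a\<^sup>2"
proof -
  have pos: "\<sigma> * sqrt (real n) > 0" using \<sigma>_pos assms(2) by simp
  have "prob {\<omega> \<in> space M. \<bar>(partial_sum X n \<omega> - real n * \<mu>) / (\<sigma> * sqrt (real n))\<bar> > a}
    \<le> prob {\<omega> \<in> space M. \<exists>r\<le>n.
      \<bar>(partial_sum X n \<omega> - real n * \<mu>) - (partial_sum X (n - r) \<omega> - real (n - r) * \<mu>)\<bar>
        \<ge> a * (\<sigma> * sqrt (real n))}"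
  proof (intro finite_measure_mono subsetI)
    fix \<omega>
    assume "\<omega> \<in> {\<omega> \<in> space M. \<bar>(partial_sum X n \<omega> - real n * \<mu>) / (\<sigma> * sqrt (real n))\<bar> > a}"
    then have \<omega>: "\<omega> \<in> space M" "a < \<bar>partial_sum X n \<omega> - real n * \<mu>\<bar> / (\<sigma> * sqrt (real n))"
      using abs_of_pos[OF pos] by (simp_all only: mem_Collect_eq abs_divide)
    then have "a * (\<sigma> * sqrt (real n)) \<le> \<bar>partial_sum X n \<omega> - real n * \<mu>\<bar>"
      using pos by (simp only: pos_less_divide_eq less_imp_le)
    then show "\<omega> \<in> {\<omega> \<in> space M. \<exists>r\<le>n.
      \<bar>(partial_sum X n \<omega> - real n * \<mu>) - (partial_sum X (n - r) \<omega> - real (n - r) * \<mu>)\<bar>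
        \<ge> a * (\<sigma> * sqrt (real n))}"
      using \<omega>(1) by (auto simp: partial_sum_def[of X 0] intro!: exI[of _ n])
  qed measurable
  also have "\<dots> \<le> real n * \<sigma>\<^sup>2 / (a * (\<sigma> * sqrt (real n)))\<^sup>2"
    using pos assms by (intro prob_backward_deviation_le) auto
  also have "\<dots> = 1 / a\<^sup>2"
    using \<sigma>_pos assms by (simp add: power_mult_distrib field_simps)
  finally show ?thesis .
qed

end

text \<open>The law of the normalized sum depends on \<nu> and the number of summands alone. So the
  central limit theorem on a single reference space is composed with the divergent index
  \<open>n\<close>.\<close>

lemma central_limit_varying_space:
  assumes iid: "\<forall>\<^sub>F i in F. iid_sequence (M i) \<nu> (X i) \<mu> \<sigma>"
    and n: "filterlim n at_top F"
  shows "conv_in_distr F M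
    (\<lambda>i \<omega>. (partial_sum (X i) (n i) \<omega> - real (n i) * \<mu>) / (\<sigma> * sqrt (real (n i))))
    std_normal_distribution"
proof (cases "F = bot")
  case True
  then show ?thesis by (simp add: conv_in_distr_def)
next
  case False
  \<comment> \<open>A proper filter supplies a reference space; for the trivial filter every
    eventual statement and every limit holds vacuously.\<close>
  then obtain i0 where i0: "iid_sequence (M i0) \<nu> (X i0) \<mu> \<sigma>"
    using iid eventually_happens by blast
  let ?Z = "\<lambda>i k \<omega>. (partial_sum (X i) k \<omega> - real k * \<mu>) / (\<sigma> * sqrt (real k))"
  define Q where "Q k = distr (M i0) borel (?Z i0 k)" for k
  have distr: "distr (M i) borel (?Z i k) =
      distr (distr (PiM {..<k} (\<lambda>_. \<nu>)) borel (\<lambda>x. \<Sum>i<k. x i)) borel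
        (\<lambda>s. (s - real k * \<mu>) / (\<sigma> * sqrt (real k)))"
    if "iid_sequence (M i) \<nu> (X i) \<mu> \<sigma>" for i k
  proof -
    interpret iid_sequence "M i" \<nu> "X i" \<mu> \<sigma> by fact
    show ?thesis by (subst distr_partial_sum[symmetric], subst distr_distr) (auto simp: comp_def)
  qed
  have Q: "distr (M i) borel (?Z i k) = Q k" if "iid_sequence (M i) \<nu> (X i) \<mu> \<sigma>" for i k
    unfolding Q_def distr[OF that] distr[OF i0] ..
  have "weak_conv_m Q std_normal_distribution"
    unfolding Q_def by (rule iid_sequence.central_limit_partial_sum[OF i0])
  then have lim: "((\<lambda>i. cdf (Q (n i)) x) \<longlongrightarrow> cdf std_normal_distribution x) F" for x
    using n isCont_cdf_std_normal
    by (auto simp: weak_conv_m_def weak_conv_def intro: filterlim_compose)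
  show ?thesis
    unfolding conv_in_distr_def
  proof (intro conjI allI impI)
    show "\<forall>\<^sub>F i in F. ?Z i (n i) \<in> borel_measurable (M i)"
      using iid
    proof eventually_elim
      case (elim i)
      interpret iid_sequence "M i" \<nu> "X i" \<mu> \<sigma> by fact
      show ?case by measurable
    qed
    fix x
    have "\<forall>\<^sub>F i in F. cdf (Q (n i)) x = cdf (distr (M i) borel (?Z i (n i))) x"
      using iid by eventually_elim (simp add: Q)
    then show "((\<lambda>i. cdf (distr (M i) borel (?Z i (n i))) x) \<longlongrightarrow> cdf std_normal_distribution x) F"
      using lim by (rule Lim_transform_eventually[rotated])
  qed
qed

lemma bounded_in_prob_partial_sum:
  assumes iid: "\<forall>\<^sub>F i in F. iid_sequence (M i) \<nu> (X i) \<mu> \<sigma>"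
    and n: "filterlim n at_top F"
  shows "bounded_in_prob F M
    (\<lambda>i \<omega>. (partial_sum (X i) (n i) \<omega> - real (n i) * \<mu>) / (\<sigma> * sqrt (real (n i))))"
  unfolding bounded_in_prob_def
proof (intro conjI allI impI)
  show "\<forall>\<^sub>F i in F. (\<lambda>\<omega>. (partial_sum (X i) (n i) \<omega> - real (n i) * \<mu>) / (\<sigma> * sqrt (real (n i))))
      \<in> borel_measurable (M i)"
    using central_limit_varying_space[OF assms] by (simp add: conv_in_distr_def)
  fix e :: real assume "e > 0"
  \<comment> \<open>Makes the Chebyshev bound \<open>1 / K\<^sup>2\<close> equal to
    \<open>e\<close>, whatever the positive number of summands.\<close>
  define K where "K = 1 / sqrt e"
  have K: "K > 0" "1 / K\<^sup>2 = e" using \<open>e > 0\<close> by (auto simp: K_def power_divide)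
  have "\<forall>\<^sub>F i in F. n i > 0" by (rule eventually_compose_filterlim[OF eventually_gt_at_top n])
  with iid have "\<forall>\<^sub>F i in F. measure (M i) {\<omega> \<in> space (M i).
      \<bar>(partial_sum (X i) (n i) \<omega> - real (n i) * \<mu>) / (\<sigma> * sqrt (real (n i)))\<bar> > K} \<le> e"
    by eventually_elim (use iid_sequence.prob_partial_sum_gt_le[OF _ K(1)] K(2) in auto)
  then show "\<exists>K>0. \<forall>\<^sub>F i in F. measure (M i) {\<omega> \<in> space (M i).
      \<bar>(partial_sum (X i) (n i) \<omega> - real (n i) * \<mu>) / (\<sigma> * sqrt (real (n i)))\<bar> > K} \<le> e"
    using K(1) by blast
qed

text \<open>
  Anscombe's theorem: the index \<^term>\<open>k i\<close> is random and may depend on the summands, which is why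
  a maximal inequality is needed.
\<close>

lemma random_index_partial_sum:
  assumes iid: "\<forall>\<^sub>F i in F. iid_sequence (M i) \<nu> (X i) \<mu> \<sigma>"
    and n: "filterlim n at_top F"
    and k: "\<forall>\<^sub>F i in F. k i \<in> measurable (M i) (count_space UNIV)"
    and le: "\<forall>\<^sub>F i in F. \<forall>\<omega>\<in>space (M i). k i \<omega> \<le> n i"
    and near: "conv_in_prob F M (\<lambda>i \<omega>. real (n i - k i \<omega>) / real (n i)) 0"
  shows "conv_in_prob F M
    (\<lambda>i \<omega>. (partial_sum (X i) (k i \<omega>) \<omega> - real (k i \<omega>) * \<mu>) / (\<sigma> * sqrt (real (n i)))
       - (partial_sum (X i) (n i) \<omega> - real (n i) * \<mu>) / (\<sigma> * sqrt (real (n i)))) 0"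
proof (rule conv_in_probI)
  show "\<forall>\<^sub>F i in F. (\<lambda>\<omega>. (partial_sum (X i) (k i \<omega>) \<omega> - real (k i \<omega>) * \<mu>) / (\<sigma> * sqrt (real (n i)))
       - (partial_sum (X i) (n i) \<omega> - real (n i) * \<mu>) / (\<sigma> * sqrt (real (n i)))) \<in> borel_measurable (M i)"
    using iid k
  proof eventually_elim
    case (elim i)
    interpret iid_sequence "M i" \<nu> "X i" \<mu> \<sigma> by fact
    note [measurable] = elim(2)
    have [measurable]: "(\<lambda>\<omega>. partial_sum (X i) (k i \<omega>) \<omega>) \<in> borel_measurable (M i)"
      by (rule measurable_compose_countable[OF _ elim(2)]) measurable
    show ?case by measurable
  qed
  fix \<eta> e :: real assume "\<eta> > 0" "e > 0"
  \<comment> \<open>The second argument of the minimum brings the maximal inequality's contribution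
    \<open>\<epsilon> / \<eta>\<^sup>2\<close> down to \<open>e / 2\<close>; the bound by 1 keeps
    the backward window inside the first \<open>n i\<close> summands.\<close>
  define \<epsilon> where "\<epsilon> = min 1 (\<eta>\<^sup>2 * e / 2)"
  have \<epsilon>: "\<epsilon> > 0" "\<epsilon> \<le> 1" "\<epsilon> / \<eta>\<^sup>2 \<le> e / 2"
    using \<open>\<eta> > 0\<close> \<open>e > 0\<close> by (auto simp: \<epsilon>_def min_def field_simps)
  have npos: "\<forall>\<^sub>F i in F. n i > 0" by (rule eventually_compose_filterlim[OF eventually_gt_at_top n])
  have "e / 2 > 0" using \<open>e > 0\<close> by simp
  show "\<forall>\<^sub>F i in F. measure (M i) {\<omega> \<in> space (M i).
      \<bar>(partial_sum (X i) (k i \<omega>) \<omega> - real (k i \<omega>) * \<mu>) / (\<sigma> * sqrt (real (n i)))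
       - (partial_sum (X i) (n i) \<omega> - real (n i) * \<mu>) / (\<sigma> * sqrt (real (n i))) - 0\<bar> > \<eta>} \<le> e"
    using npos iid k le conv_in_probD[OF near \<epsilon>(1) \<open>e / 2 > 0\<close>]
  proof eventually_elim
    case (elim i)
    interpret iid_sequence "M i" \<nu> "X i" \<mu> \<sigma> by fact
    note [measurable] = elim(3)
    let ?S = "\<lambda>j \<omega>. partial_sum (X i) j \<omega> - real j * \<mu>"
    define c where "c = \<sigma> * sqrt (real (n i))"
    have c: "c > 0" "c\<^sup>2 = \<sigma>\<^sup>2 * real (n i)"
      using \<sigma>_pos elim(1) by (auto simp: c_def power_mult_distrib)
    \<comment> \<open>The furthest that \<open>k i \<omega>\<close> can lie behind
      \<open>n i\<close> outside the event \<open>?A\<close>.\<close>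
    define m where "m = nat \<lfloor>\<epsilon> * real (n i)\<rfloor>"
    have m: "real m \<le> \<epsilon> * real (n i)" using \<epsilon>(1) by (simp add: m_def)
    also have "\<dots> \<le> real (n i)" using \<epsilon>(1,2) by (intro mult_left_le_one_le) auto
    finally have mn: "m \<le> n i" by simp
    let ?A = "{\<omega> \<in> space (M i). \<bar>real (n i - k i \<omega>) / real (n i) - 0\<bar> > \<epsilon>}"
    let ?B = "{\<omega> \<in> space (M i). \<exists>r\<le>m. \<bar>?S (n i) \<omega> - ?S (n i - r) \<omega>\<bar> \<ge> \<eta> * c}"
    have [measurable]: "?B \<in> events" by measurable
    have "\<omega> \<in> ?A \<union> ?B" if \<omega>: "\<omega> \<in> space (M i)" and gt: "\<bar>?S (k i \<omega>) \<omega> / c - ?S (n i) \<omega> / c\<bar> > \<eta>" for \<omega>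
    proof (rule ccontr)
      assume nAB: "\<omega> \<notin> ?A \<union> ?B"
      then have "real (n i - k i \<omega>) \<le> \<epsilon> * real (n i)" using \<omega> elim(1) by (simp add: field_simps)
      then have "n i - k i \<omega> \<le> m" unfolding m_def by (simp add: le_nat_iff le_floor_iff)
      \<comment> \<open>The witness for \<open>?B\<close> is \<open>r = n i - k i \<omega>\<close>;
        because the index never exceeds \<open>n i\<close>, truncated subtraction recovers
        it.\<close>
      moreover have "n i - (n i - k i \<omega>) = k i \<omega>" using elim(4) \<omega> by simp
      ultimately have "\<bar>?S (n i) \<omega> - ?S (k i \<omega>) \<omega>\<bar> < \<eta> * c" using nAB \<omega> by force
      moreover have "\<bar>?S (n i) \<omega> - ?S (k i \<omega>) \<omega>\<bar> = \<bar>?S (k i \<omega>) \<omega> / c - ?S (n i) \<omega> / c\<bar> * c"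
        using c(1) by (simp add: abs_divide flip: diff_divide_distrib)
      ultimately show False using gt c(1) by simp
    qed
    then have "prob {\<omega> \<in> space (M i). \<bar>?S (k i \<omega>) \<omega> / c - ?S (n i) \<omega> / c - 0\<bar> > \<eta>} \<le> prob (?A \<union> ?B)"
      by (intro finite_measure_mono) auto
    also have "\<dots> \<le> prob ?A + prob ?B" by (intro measure_Un_le) measurable
    also have "prob ?B \<le> real m * \<sigma>\<^sup>2 / (\<eta> * c)\<^sup>2"
      using mn c \<open>\<eta> > 0\<close> by (intro prob_backward_deviation_le) auto
    also have "\<dots> \<le> (\<epsilon> * real (n i)) * \<sigma>\<^sup>2 / (\<eta> * c)\<^sup>2"
      using m by (intro divide_right_mono mult_right_mono) auto
    also have "\<dots> = \<epsilon> / \<eta>\<^sup>2"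
      using elim(1) \<sigma>_pos by (simp add: power_mult_distrib c(2) field_simps)
    finally show ?case using elim(5) \<epsilon>(3) unfolding c_def by linarith
  qed
qed

subsection \<open>The age of a renewal process\<close>

text \<open>Telescoping: \<open>1 / (x + L)\<^sup>2\<close> is at most
  \<open>1 / (x * (x + L))\<close>, a difference of consecutive terms \<open>1 / (L * x)\<close>.
  The first such \<open>x\<close> is \<open>s - L\<close>, hence \<open>s > L\<close>. The
  subtracted term carries the induction.\<close>

lemma sum_inverse_squares_le:
  fixes L s :: real
  assumes "L > 0" "s > L"
  shows "(\<Sum>j\<le>m. 1 / (s + real j * L)\<^sup>2) \<le> 1 / (L * (s - L)) - 1 / (L * (s + real m * L))"
proof -
  have step: "1 / (x + L)\<^sup>2 \<le> 1 / (L * x) - 1 / (L * (x + L))" if "x > 0" for x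
  proof -
    have num: "L * (x + L) - L * x = L * L" by (simp add: distrib_left)
    have den: "(L * x) * (L * (x + L)) = (L * L) * (x * (x + L))" by (simp only: mult_ac)
    have "1 / (L * x) - 1 / (L * (x + L)) = (1 * (L * (x + L)) - 1 * (L * x)) / ((L * x) * (L * (x + L)))"
      using that assms(1) by (intro diff_frac_eq) auto
    also have "\<dots> = 1 / (x * (x + L))"
      unfolding mult_1 num den using assms(1) by simp
    finally have "1 / (L * x) - 1 / (L * (x + L)) = 1 / (x * (x + L))" .
    moreover have "1 / (x + L)\<^sup>2 \<le> 1 / (x * (x + L))"
      using that assms(1) by (intro divide_left_mono) (auto simp: power2_eq_square)
    ultimately show ?thesis by simp
  qed
  show ?thesis
  proof (induction m)
    case 0
    then show ?case using step[of "s - L"] assms by simp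
  next
    case (Suc m)
    have "s + real m * L > 0" using assms by (simp add: add_pos_nonneg)
    note step' = step[OF this]
    have e: "s + real (Suc m) * L = s + real m * L + L" by (simp add: distrib_right)
    show ?case unfolding sum.atMost_Suc e using step' Suc.IH by linarith
  qed
qed

section \<open>Renewal processes on a single probability space\<close>

locale renewal_sequence = prob_space +
  fixes \<tau> :: "nat \<Rightarrow> 'a \<Rightarrow> nat"
  assumes renewal: "renewal_process M \<tau>"
begin

definition increment :: "nat \<Rightarrow> 'a \<Rightarrow> nat" where
  "increment n \<omega> = \<tau> (Suc n) \<omega> - \<tau> n \<omega>"

lemma renewal_0: "\<omega> \<in> space M \<Longrightarrow> \<tau> 0 \<omega> = 0"
  using renewal by (simp add: renewal_process_def)

lemma renewal_strict_mono: "\<omega> \<in> space M \<Longrightarrow> strict_mono (\<lambda>n. \<tau> n \<omega>)"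
  using renewal by (simp add: renewal_process_def strict_mono_Suc_iff)

lemma renewal_Suc: "\<omega> \<in> space M \<Longrightarrow> \<tau> (Suc n) \<omega> = \<tau> n \<omega> + increment n \<omega>"
  using strict_mono_less[OF renewal_strict_mono, of \<omega> n "Suc n"] by (simp add: increment_def)

lemma renewal_eq_sum: "\<omega> \<in> space M \<Longrightarrow> \<tau> n \<omega> = (\<Sum>i<n. increment i \<omega>)"
  by (induction n) (simp_all add: renewal_0 renewal_Suc)

lemma le_renewal: "\<omega> \<in> space M \<Longrightarrow> n \<le> \<tau> n \<omega>"
  using strict_mono_imp_increasing[OF renewal_strict_mono] .

lemma indep_increment: "indep_vars (\<lambda>_. count_space UNIV) increment UNIV"
  using renewal by (simp add: renewal_process_def iid_def increment_def[abs_def])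

lemma measurable_increment [measurable]: "increment n \<in> measurable M (count_space UNIV)"
  using indep_increment by (simp add: indep_vars_def2)

lemma measurable_renewal [measurable]: "\<tau> n \<in> measurable M (count_space UNIV)"
proof -
  have "(\<lambda>\<omega>. \<Sum>i<n. increment i \<omega>) \<in> measurable M (count_space UNIV)" by measurable
  then show ?thesis by (rule measurable_cong[THEN iffD1, rotated]) (simp add: renewal_eq_sum)
qed

lemma prob_increment: "prob {\<omega> \<in> space M. P (increment n \<omega>)} = prob {\<omega> \<in> space M. P (\<tau> 1 \<omega>)}"
proof -
  have "distr M (count_space UNIV) (increment n) = distr M (count_space UNIV) (\<tau> 1)"
    using renewal by (simp add: renewal_process_def iid_def increment_def[abs_def])
  then have "measure (distr M (count_space UNIV) (increment n)) {k. P k} =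
      measure (distr M (count_space UNIV) (\<tau> 1)) {k. P k}" by simp
  then show ?thesis by (simp add: measure_distr vimage_def Int_def conj_commute)
qed

text \<open>The time \<open>\<tau> n\<close> is the sum of the increments before index
  \<open>n\<close>, hence independent of increment \<open>n\<close>, which has the law of
  \<open>\<tau> 1\<close>.\<close>

lemma prob_renewal_increment:
  "prob {\<omega> \<in> space M. P (\<tau> n \<omega>) \<and> Q (increment n \<omega>)} =
   prob {\<omega> \<in> space M. P (\<tau> n \<omega>)} * prob {\<omega> \<in> space M. Q (\<tau> 1 \<omega>)}"
proof -
  \<comment> \<open>The increments are cast to reals because \<open>indep_vars_sum\<close> is
    applied to real-valued summands.\<close>
  have "indep_vars (\<lambda>_. borel) (\<lambda>i \<omega>. real (increment i \<omega>)) UNIV"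
    by (rule indep_vars_compose2[OF indep_increment]) auto
  then have "indep_vars (\<lambda>_. borel) (\<lambda>i \<omega>. real (increment i \<omega>)) (insert n {..<n})"
    by (rule indep_vars_subset) auto
  then have ind: "indep_var borel (\<lambda>\<omega>. real (increment n \<omega>)) borel (\<lambda>\<omega>. \<Sum>i<n. real (increment i \<omega>))"
    by (intro indep_vars_sum) auto
  \<comment> \<open>Any set of naturals has a countable, hence Borel, image, so \<open>P\<close> and
    \<open>Q\<close> may be arbitrary predicates.\<close>
  have [simp]: "real ` A \<in> sets borel" for A
    by (rule sets.countable) auto
  have real_eq: "(\<Sum>i<n. real (increment i \<omega>)) = real (\<tau> n \<omega>)" if "\<omega> \<in> space M" for \<omega>
    using renewal_eq_sum[OF that, of n] by simp
  have mem: "real k \<in> real ` A \<longleftrightarrow> k \<in> A" for k A by auto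
  have "prob {\<omega> \<in> space M. P (\<tau> n \<omega>) \<and> Q (increment n \<omega>)} =
    prob ((\<lambda>\<omega>. (real (increment n \<omega>), \<Sum>i<n. real (increment i \<omega>))) -`
      (real ` Collect Q \<times> real ` Collect P) \<inter> space M)"
    by (intro arg_cong[where f = prob]) (auto simp: real_eq mem)
  also have "\<dots> = prob ((\<lambda>\<omega>. real (increment n \<omega>)) -` (real ` Collect Q) \<inter> space M) *
      prob ((\<lambda>\<omega>. \<Sum>i<n. real (increment i \<omega>)) -` (real ` Collect P) \<inter> space M)"
    by (intro indep_varD[OF ind]) auto
  also have "(\<lambda>\<omega>. real (increment n \<omega>)) -` (real ` Collect Q) \<inter> space M =
      {\<omega> \<in> space M. Q (increment n \<omega>)}"
    by (auto simp: mem)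
  also have "(\<lambda>\<omega>. \<Sum>i<n. real (increment i \<omega>)) -` (real ` Collect P) \<inter> space M =
      {\<omega> \<in> space M. P (\<tau> n \<omega>)}"
    by (auto simp: real_eq mem)
  finally show ?thesis by (simp add: prob_increment mult.commute)
qed

text \<open>The set under \<open>Max\<close> is an initial segment by monotonicity, finite because
  \<open>n \<le> \<tau> n \<omega>\<close>, and contains 0. Its maximum is therefore the index that
  belongs to it while its successor does not.\<close>

lemma renewal_count_eq:
  assumes "\<omega> \<in> space M"
  shows "renewal_count \<tau> t \<omega> = n \<longleftrightarrow> \<tau> n \<omega> \<le> t \<and> t < \<tau> (Suc n) \<omega>"
proof -
  let ?N = "{n. \<tau> n \<omega> \<le> t}"
  note mono = strict_mono_less_eq[OF renewal_strict_mono[OF assms]]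
  have "?N \<subseteq> {..t}" using le_trans[OF le_renewal[OF assms]] by blast
  then have fin: "finite ?N" by (rule finite_subset) simp
  have "0 \<in> ?N" using renewal_0[OF assms] by simp
  then have ne: "?N \<noteq> {}" by (metis empty_iff)
  have "n \<in> ?N \<and> Suc n \<notin> ?N \<longleftrightarrow> n \<in> ?N \<and> (\<forall>k\<in>?N. k \<le> n)"
  proof
    assume n: "n \<in> ?N \<and> Suc n \<notin> ?N"
    have "k \<le> n" if "k \<in> ?N" for k
    proof (rule ccontr)
      assume "\<not> k \<le> n"
      then have "\<tau> (Suc n) \<omega> \<le> \<tau> k \<omega>" using mono[of "Suc n" k] by simp
      with n that show False by simp
    qed
    with n show "n \<in> ?N \<and> (\<forall>k\<in>?N. k \<le> n)" by blast
  next
    assume "n \<in> ?N \<and> (\<forall>k\<in>?N. k \<le> n)"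
    then show "n \<in> ?N \<and> Suc n \<notin> ?N" using Suc_n_not_le_n[of n] by (metis (no_types))
  qed
  then have "Max ?N = n \<longleftrightarrow> n \<in> ?N \<and> Suc n \<notin> ?N"
    unfolding Max_eq_iff[OF fin ne] by (rule sym)
  then show ?thesis
    unfolding renewal_count_def mem_Collect_eq not_le .
qed

lemma last_renewal_le: "\<omega> \<in> space M \<Longrightarrow> last_renewal \<tau> t \<omega> \<le> t"
  using renewal_count_eq[of \<omega> t "renewal_count \<tau> t \<omega>"] by (simp add: last_renewal_def)

lemma last_renewal_pos:
  assumes "\<omega> \<in> space M" "\<tau> 1 \<omega> \<le> t"
  shows "last_renewal \<tau> t \<omega> > 0"
proof -
  have "renewal_count \<tau> t \<omega> \<noteq> 0"
    using assms by (simp add: renewal_count_eq)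
  then show ?thesis
    using le_renewal[OF assms(1), of "renewal_count \<tau> t \<omega>"] by (simp add: last_renewal_def)
qed

text \<open>Before the first renewal the age is therefore all of \<open>t\<close>, which makes this
  event unlikely once the age is known to be small relative to \<open>t\<close>.\<close>

lemma last_renewal_eq_0:
  assumes "\<omega> \<in> space M" "\<not> \<tau> 1 \<omega> \<le> t"
  shows "last_renewal \<tau> t \<omega> = 0"
proof -
  have "renewal_count \<tau> t \<omega> = 0"
    using assms by (simp add: renewal_count_eq renewal_0)
  then show ?thesis by (simp add: last_renewal_def renewal_0 assms)
qed

lemma measurable_last_renewal [measurable]: "last_renewal \<tau> t \<in> measurable M (count_space UNIV)"
proof -
  have "renewal_count \<tau> t \<in> measurable M (count_space UNIV)"
  proof (rule measurable_count_space_eq_countable[THEN iffD2])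
    have "renewal_count \<tau> t -` {n} \<inter> space M = {\<omega> \<in> space M. \<tau> n \<omega> \<le> t \<and> t < \<tau> (Suc n) \<omega>}" for n
      using renewal_count_eq[of _ t n] by blast
    moreover have "{\<omega> \<in> space M. \<tau> n \<omega> \<le> t \<and> t < \<tau> (Suc n) \<omega>} \<in> events" for n
      by measurable
    ultimately show "renewal_count \<tau> t \<in> space M \<rightarrow> UNIV \<and>
        (\<forall>n\<in>UNIV. renewal_count \<tau> t -` {n} \<inter> space M \<in> events)" by auto
  qed simp
  then show ?thesis
    unfolding last_renewal_def[abs_def] by (rule measurable_compose_countable[OF measurable_renewal])
qed

text \<open>
  A renewal in a window of length \<^term>\<open>L\<close> that is followed by an increment larger than
  \<^term>\<open>L\<close> is the last one in the window, so these events are disjoint for distinct indices.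
\<close>

lemma expected_renewals_in_window:
  "(\<Sum>n\<le>m. prob {\<omega> \<in> space M. a - L < real (\<tau> n \<omega>) \<and> real (\<tau> n \<omega>) \<le> a})
     * prob {\<omega> \<in> space M. L < real (\<tau> 1 \<omega>)} \<le> 1"
proof -
  define E where "E n = {\<omega> \<in> space M. (a - L < real (\<tau> n \<omega>) \<and> real (\<tau> n \<omega>) \<le> a) \<and>
    L < real (increment n \<omega>)}" for n
  have PE: "prob (E n) = prob {\<omega> \<in> space M. a - L < real (\<tau> n \<omega>) \<and> real (\<tau> n \<omega>) \<le> a}
      * prob {\<omega> \<in> space M. L < real (\<tau> 1 \<omega>)}" for n
    unfolding E_def
    by (rule prob_renewal_increment[of "\<lambda>k. a - L < real k \<and> real k \<le> a" n "\<lambda>k. L < real k"])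
  have E [measurable]: "E n \<in> events" for n unfolding E_def by measurable
  have disj: "E i \<inter> E j = {}" if "i < j" for i j
  proof (rule ccontr)
    assume "E i \<inter> E j \<noteq> {}"
    then obtain \<omega> where \<omega>: "\<omega> \<in> space M" "a - L < real (\<tau> i \<omega>)" "L < real (increment i \<omega>)"
      "real (\<tau> j \<omega>) \<le> a" by (auto simp: E_def)
    have "\<tau> (Suc i) \<omega> \<le> \<tau> j \<omega>"
      using strict_mono_less_eq[OF renewal_strict_mono[OF \<omega>(1)]] that by simp
    then have "real (\<tau> i \<omega>) + real (increment i \<omega>) \<le> real (\<tau> j \<omega>)"
      by (simp add: renewal_Suc[OF \<omega>(1)])
    with \<omega> show False by linarith
  qed
  have "disjoint_family_on E {..m}"
    unfolding disjoint_family_on_def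
  proof (intro ballI impI)
    fix i j :: nat assume "i \<noteq> j"
    then show "E i \<inter> E j = {}" by (metis disj Int_commute linorder_less_linear)
  qed
  then have "(\<Sum>n\<le>m. prob (E n)) = prob (\<Union>n\<le>m. E n)"
    using E by (intro finite_measure_finite_Union[symmetric] image_subsetI) auto
  also have "\<dots> \<le> 1" by (rule prob_le_1)
  finally show ?thesis by (simp only: PE sum_distrib_right)
qed

text \<open>A union bound over windows and indices, with each term factored by independence. The
  expected number of renewals per window is at most \<open>1 / q\<close>, Markov's inequality for
  the square bounds the long increment by \<open>B / (s + real j * L)\<^sup>2\<close>, and the sum
  over windows telescopes.\<close>

lemma prob_age_ge_le:
  assumes int: "integrable M (\<lambda>\<omega>. (real (\<tau> 1 \<omega>))\<^sup>2)"
    and B: "expectation (\<lambda>\<omega>. (real (\<tau> 1 \<omega>))\<^sup>2) \<le> B"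
    and q: "q > 0" "q \<le> prob {\<omega> \<in> space M. L < real (\<tau> 1 \<omega>)}"
    and L: "L > 0" "s > L"
  shows "prob {\<omega> \<in> space M. s \<le> real (t - last_renewal \<tau> t \<omega>)} \<le> B / (q * L * (s - L))"
proof -
  let ?p = "\<lambda>x. prob {\<omega> \<in> space M. x < real (\<tau> 1 \<omega>)}"
  \<comment> \<open>Window \<open>j\<close> ends at distance \<open>s + real j * L\<close> before
    \<open>t\<close>, so an increment starting there must exceed that distance to pass
    \<open>t\<close>. The endpoints are real and may be negative.\<close>
  define W where "W j n \<omega> \<longleftrightarrow> (real t - s - real j * L) - L < real (\<tau> n \<omega>) \<and>
    real (\<tau> n \<omega>) \<le> real t - s - real j * L" for j n \<omega>
  define E where "E j n = {\<omega> \<in> space M. W j n \<omega> \<and> s + real j * L < real (increment n \<omega>)}" for j n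
  define J where "J = nat \<lfloor>real t / L\<rfloor>"
  have PE: "prob (E j n) = prob {\<omega> \<in> space M. W j n \<omega>} * ?p (s + real j * L)" for j n
    unfolding E_def W_def
    by (rule prob_renewal_increment[of "\<lambda>k. real t - s - real j * L - L < real k \<and> real k \<le> real t - s - real j * L"
          n "\<lambda>k. s + real j * L < real k"])
  have [measurable]: "E j n \<in> events" for j n unfolding E_def W_def by measurable
  have "expectation (\<lambda>\<omega>. (real (\<tau> 1 \<omega>))\<^sup>2) \<ge> 0" by (rule integral_nonneg_AE) simp
  with B have "B \<ge> 0" by linarith
  have p: "?p x \<le> B / x\<^sup>2" if "x > 0" for x
  proof -
    have "?p x \<le> prob {\<omega> \<in> space M. x\<^sup>2 \<le> (real (\<tau> 1 \<omega>))\<^sup>2}"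
      using that by (intro finite_measure_mono) auto
    also have "\<dots> \<le> expectation (\<lambda>\<omega>. (real (\<tau> 1 \<omega>))\<^sup>2) / x\<^sup>2"
      using int that by (intro integral_Markov_inequality_measure[where A = "space M"]) auto
    also have "\<dots> \<le> B / x\<^sup>2" using B by (intro divide_right_mono) auto
    finally show ?thesis .
  qed
  have "{\<omega> \<in> space M. s \<le> real (t - last_renewal \<tau> t \<omega>)} \<subseteq> (\<Union>j\<le>J. \<Union>n\<le>t. E j n)"
  proof
    fix \<omega> assume "\<omega> \<in> {\<omega> \<in> space M. s \<le> real (t - last_renewal \<tau> t \<omega>)}"
    then have \<omega>: "\<omega> \<in> space M" "s \<le> real (t - last_renewal \<tau> t \<omega>)" by auto
    define n where "n = renewal_count \<tau> t \<omega>"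
    have n: "\<tau> n \<omega> \<le> t" "t < \<tau> (Suc n) \<omega>"
      using renewal_count_eq[OF \<omega>(1), of t n] by (simp_all add: n_def)
    have "n \<le> t" using n(1) le_renewal[OF \<omega>(1), of n] by simp
    \<comment> \<open>The excess of the age over \<open>s\<close>; dividing it by \<open>L\<close>
      and rounding down gives the window of the last renewal.\<close>
    define x where "x = real t - s - real (\<tau> n \<omega>)"
    have x: "x \<ge> 0" "x \<le> real t"
      using \<omega>(2) n(1) L by (simp_all add: x_def last_renewal_def n_def of_nat_diff)
    define j where "j = nat \<lfloor>x / L\<rfloor>"
    have "real j \<le> x / L" "x / L < real j + 1" using x(1) L(1) by (simp_all add: j_def)
    then have j: "real j * L \<le> x" "x < real j * L + L" using L(1) by (simp_all add: field_simps)
    have "j \<le> J" unfolding j_def J_def using x L(1)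
      by (intro nat_mono floor_mono divide_right_mono) auto
    have "real t < real (\<tau> n \<omega>) + real (increment n \<omega>)"
      using n(2) renewal_Suc[OF \<omega>(1), of n] by simp
    then have "\<omega> \<in> E j n" using \<omega>(1) j by (simp add: E_def W_def x_def)
    with \<open>j \<le> J\<close> \<open>n \<le> t\<close> show "\<omega> \<in> (\<Union>j\<le>J. \<Union>n\<le>t. E j n)" by blast
  qed
  then have "prob {\<omega> \<in> space M. s \<le> real (t - last_renewal \<tau> t \<omega>)} \<le> prob (\<Union>j\<le>J. \<Union>n\<le>t. E j n)"
    by (intro finite_measure_mono) auto
  also have "\<dots> \<le> (\<Sum>j\<le>J. prob (\<Union>n\<le>t. E j n))"
    by (intro finite_measure_subadditive_finite) auto
  also have "\<dots> \<le> (\<Sum>j\<le>J. \<Sum>n\<le>t. prob (E j n))"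
    by (intro sum_mono finite_measure_subadditive_finite) auto
  also have "\<dots> = (\<Sum>j\<le>J. (\<Sum>n\<le>t. prob {\<omega> \<in> space M. W j n \<omega>}) * ?p (s + real j * L))"
    by (simp only: PE sum_distrib_right)
  also have "\<dots> \<le> (\<Sum>j\<le>J. 1 / q * (B * (1 / (s + real j * L)\<^sup>2)))"
  proof (intro sum_mono mult_mono)
    fix j
    have "(\<Sum>n\<le>t. prob {\<omega> \<in> space M. W j n \<omega>}) * q
        \<le> (\<Sum>n\<le>t. prob {\<omega> \<in> space M. W j n \<omega>}) * ?p L"
      by (intro mult_left_mono q(2) sum_nonneg) auto
    also have "\<dots> \<le> 1" unfolding W_def by (rule expected_renewals_in_window)
    finally show "(\<Sum>n\<le>t. prob {\<omega> \<in> space M. W j n \<omega>}) \<le> 1 / q" using q(1) by (simp add: field_simps)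
    have "s + real j * L > 0" using L by (simp add: add_pos_nonneg)
    from p[OF this] show "?p (s + real j * L) \<le> B * (1 / (s + real j * L)\<^sup>2)" by simp
  qed (use q in auto)
  also have "\<dots> = B / q * (\<Sum>j\<le>J. 1 / (s + real j * L)\<^sup>2)"
    by (simp add: sum_distrib_left)
  also have "\<dots> \<le> B / q * (1 / (L * (s - L)))"
  proof (intro mult_left_mono)
    \<comment> \<open>Dropping the telescoped remainder removes \<open>J\<close>, and with it
      \<open>t\<close>, from the bound.\<close>
    have "1 / (L * (s + real J * L)) \<ge> 0" using L by simp
    with sum_inverse_squares_le[OF L, of J]
    show "(\<Sum>j\<le>J. 1 / (s + real j * L)\<^sup>2) \<le> 1 / (L * (s - L))" by linarith
  qed (use \<open>B \<ge> 0\<close> q in auto)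
  finally show ?thesis by (simp add: mult.assoc)
qed

text \<open>Paley--Zygmund: by AM-GM, \<open>u \<le> u\<^sup>2 / (4 * A * \<delta>) + A * \<delta>\<close>, which is applied where \<open>u > \<delta> / 2\<close>.\<close>

lemma prob_increment_gt_half_mean:
  assumes int: "integrable M (\<lambda>\<omega>. (real (\<tau> 1 \<omega>))\<^sup>2)"
    and mean: "expectation (\<lambda>\<omega>. real (\<tau> 1 \<omega>)) = \<delta>" "\<delta> > 0"
    and A: "expectation (\<lambda>\<omega>. (real (\<tau> 1 \<omega>))\<^sup>2) \<le> A * \<delta>\<^sup>2" "A > 0"
  shows "1 / (4 * A) \<le> prob {\<omega> \<in> space M. \<delta> / 2 < real (\<tau> 1 \<omega>)}"
proof -
  define G where "G = {\<omega> \<in> space M. \<delta> / 2 < real (\<tau> 1 \<omega>)}"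
  have G [measurable]: "G \<in> events" unfolding G_def by measurable
  have [simp]: "integrable M (indicat_real G)"
    using G by (intro integrable_real_indicator) (auto simp: less_top[symmetric])
  have int1: "integrable M (\<lambda>\<omega>. real (\<tau> 1 \<omega>))"
    by (rule square_integrable_imp_integrable[OF _ int]) simp
  have pt: "u \<le> \<delta> / 2 + u\<^sup>2 / (4 * A * \<delta>) + A * \<delta> * (if \<delta> / 2 < u then 1 else 0)" if "u \<ge> 0" for u
  proof (cases "\<delta> / 2 < u")
    case True
    \<comment> \<open>AM-GM as a completed square; its expansion is the inequality wanted when
      \<open>u\<close> exceeds half the mean.\<close>
    have "(u - 2 * A * \<delta>)\<^sup>2 / (4 * A * \<delta>) \<ge> 0" using mean A by simp
    moreover have "(u - 2 * A * \<delta>)\<^sup>2 / (4 * A * \<delta>) = u\<^sup>2 / (4 * A * \<delta>) + A * \<delta> - u"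
      using mean A by (simp add: field_simps power2_eq_square)
    ultimately show ?thesis using True mean by simp
  next
    case False
    moreover have "u\<^sup>2 / (4 * A * \<delta>) \<ge> 0" using mean(2) A(2) by simp
    ultimately show ?thesis by simp
  qed
  have "expectation (\<lambda>\<omega>. real (\<tau> 1 \<omega>)) \<le> expectation (\<lambda>\<omega>. \<delta> / 2 + (real (\<tau> 1 \<omega>))\<^sup>2 / (4 * A * \<delta>) + A * \<delta> * indicator G \<omega>)"
  proof (rule integral_mono[OF int1])
    show "integrable M (\<lambda>\<omega>. \<delta> / 2 + (real (\<tau> 1 \<omega>))\<^sup>2 / (4 * A * \<delta>) + A * \<delta> * indicator G \<omega>)"
      using int by simp
    show "real (\<tau> 1 \<omega>) \<le> \<delta> / 2 + (real (\<tau> 1 \<omega>))\<^sup>2 / (4 * A * \<delta>) + A * \<delta> * indicator G \<omega>"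
      if "\<omega> \<in> space M" for \<omega>
      using pt[of "real (\<tau> 1 \<omega>)"] that by (auto simp: indicator_def G_def split: if_splits)
  qed
  also have "\<dots> = \<delta> / 2 + expectation (\<lambda>\<omega>. (real (\<tau> 1 \<omega>))\<^sup>2) / (4 * A * \<delta>) + A * \<delta> * prob G"
    using int G by (simp add: prob_space)
  also have "\<dots> \<le> \<delta> / 2 + A * \<delta>\<^sup>2 / (4 * A * \<delta>) + A * \<delta> * prob G"
    using mean A by (intro add_mono divide_right_mono order_refl) auto
  also have "A * \<delta>\<^sup>2 / (4 * A * \<delta>) = \<delta> / 4" using mean A by (simp add: power2_eq_square)
  finally have "\<delta> \<le> \<delta> / 2 + \<delta> / 4 + A * \<delta> * prob G" unfolding mean(1) .
  \<comment> \<open>Half of the mean comes from small values and a quarter from the second moment,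
    so the last quarter must come from \<open>G\<close>.\<close>
  then have "1 / 4 * \<delta> \<le> (A * prob G) * \<delta>" by (simp add: algebra_simps)
  then have "1 / 4 \<le> A * prob G" using mean(2) by (rule mult_right_le_imp_le)
  then show ?thesis unfolding G_def[symmetric] using A by (simp add: field_simps)
qed

text \<open>The previous bounds with \<open>L = \<delta> / 2\<close>, \<open>q = 1 / (4 * A)\<close>
  and \<open>B = A * \<delta>\<^sup>2\<close>. The condition \<open>s \<ge> \<delta>\<close> gives
  \<open>s - \<delta> / 2 \<ge> s / 2\<close>, whence the constant 16.\<close>

lemma prob_age_le:
  assumes int: "integrable M (\<lambda>\<omega>. (real (\<tau> 1 \<omega>))\<^sup>2)"
    and mean: "expectation (\<lambda>\<omega>. real (\<tau> 1 \<omega>)) = \<delta>" "\<delta> > 0"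
    and A: "expectation (\<lambda>\<omega>. (real (\<tau> 1 \<omega>))\<^sup>2) \<le> A * \<delta>\<^sup>2" "A > 0"
    and s: "s \<ge> \<delta>"
  shows "prob {\<omega> \<in> space M. s \<le> real (t - last_renewal \<tau> t \<omega>)} \<le> 16 * A\<^sup>2 * (\<delta> / s)"
proof -
  have "prob {\<omega> \<in> space M. s \<le> real (t - last_renewal \<tau> t \<omega>)}
      \<le> A * \<delta>\<^sup>2 / (1 / (4 * A) * (\<delta> / 2) * (s - \<delta> / 2))"
    using s mean A by (intro prob_age_ge_le int prob_increment_gt_half_mean) auto
  also have "\<dots> \<le> A * \<delta>\<^sup>2 / (1 / (4 * A) * (\<delta> / 2) * (s / 2))"
    using s mean A by (intro divide_left_mono mult_left_mono mult_pos_pos) auto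
  also have "\<dots> = 16 * A\<^sup>2 * (\<delta> / s)"
    using s mean A by (simp add: power2_eq_square)
  finally show ?thesis .
qed

end

text \<open>The age is of order \<delta> in probability, so it is negligible at every scale
  \<open>b\<close> that dominates \<delta>. The scale is left free because both \<open>t\<close> and
  its square root are used.\<close>

lemma age_conv_in_prob_0:
  assumes ren: "\<forall>\<^sub>F i in F. renewal_sequence (M i) (\<tau> i)"
    and mean: "\<forall>\<^sub>F i in F. integral\<^sup>L (M i) (\<lambda>\<omega>. real (\<tau> i 1 \<omega>)) = \<delta> i" "\<forall>\<^sub>F i in F. \<delta> i > 0"
    and int: "\<forall>\<^sub>F i in F. integrable (M i) (\<lambda>\<omega>. (real (\<tau> i 1 \<omega>))\<^sup>2)"
    and A: "A > 0" "\<forall>\<^sub>F i in F. integral\<^sup>L (M i) (\<lambda>\<omega>. (real (\<tau> i 1 \<omega>))\<^sup>2) \<le> A * (\<delta> i)\<^sup>2"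
    and b: "((\<lambda>i. \<delta> i / b i) \<longlongrightarrow> 0) F" "\<forall>\<^sub>F i in F. b i > 0"
  shows "conv_in_prob F M (\<lambda>i \<omega>. real (t i - last_renewal (\<tau> i) (t i) \<omega>) / b i) 0"
proof (rule conv_in_probI)
  show "\<forall>\<^sub>F i in F. (\<lambda>\<omega>. real (t i - last_renewal (\<tau> i) (t i) \<omega>) / b i) \<in> borel_measurable (M i)"
    using ren
  proof eventually_elim
    case (elim i)
    interpret renewal_sequence "M i" "\<tau> i" by fact
    show ?case by measurable
  qed
  fix \<eta> e :: real assume "\<eta> > 0" "e > 0"
  \<comment> \<open>An eventual bound for \<open>\<delta> i / b i\<close>: the first argument
    ensures \<open>\<delta> i \<le> \<eta> * b i\<close>, as \<open>prob_age_le\<close> requires,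
    and the second brings its bound below \<open>e\<close>.\<close>
  define c where "c = min \<eta> (\<eta> * e / (16 * A\<^sup>2))"
  have "c > 0" using \<open>\<eta> > 0\<close> \<open>e > 0\<close> A(1) by (simp add: c_def)
  have c: "c \<le> \<eta>" "16 * A\<^sup>2 * (c / \<eta>) \<le> e"
    using \<open>\<eta> > 0\<close> A(1) by (auto simp: c_def min_def field_simps)
  from order_tendstoD(2)[OF b(1) \<open>c > 0\<close>] b(2) ren mean int A(2)
  show "\<forall>\<^sub>F i in F. measure (M i)
      {\<omega> \<in> space (M i). \<bar>real (t i - last_renewal (\<tau> i) (t i) \<omega>) / b i - 0\<bar> > \<eta>} \<le> e"
  proof eventually_elim
    case (elim i)
    interpret renewal_sequence "M i" "\<tau> i" by fact
    have \<delta>: "\<delta> i \<le> c * b i" using elim(1,2) by (simp add: field_simps)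
    also have "\<dots> \<le> \<eta> * b i" using c(1) elim(2) by (intro mult_right_mono) auto
    finally have s: "\<delta> i \<le> \<eta> * b i" .
    have "prob {\<omega> \<in> space (M i). \<bar>real (t i - last_renewal (\<tau> i) (t i) \<omega>) / b i - 0\<bar> > \<eta>}
        \<le> prob {\<omega> \<in> space (M i). \<eta> * b i \<le> real (t i - last_renewal (\<tau> i) (t i) \<omega>)}"
      using elim(2) by (intro finite_measure_mono) (auto simp: field_simps)
    also have "\<dots> \<le> 16 * A\<^sup>2 * (\<delta> i / (\<eta> * b i))"
      using elim A(1) s by (intro prob_age_le) auto
    also have "\<dots> \<le> 16 * A\<^sup>2 * (c * b i / (\<eta> * b i))"
      using \<delta> elim(2) \<open>\<eta> > 0\<close> by (intro mult_left_mono divide_right_mono) auto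
    also have "\<dots> \<le> e" using c(2) elim(2) by simp
    finally show ?case .
  qed
qed

subsection \<open>Means sampled at the last renewal\<close>

text \<open>Both processes live on the same space \<open>M i\<close>, with no independence assumed
  between them. Except for the signs of \<open>A\<close> and \<open>\<sigma>\<close>, everything is
  required only along the filter.\<close>

locale renewal_sampling =
  fixes F :: "'i filter" and M :: "'i \<Rightarrow> 'a measure" and \<nu> :: "real measure"
    and X :: "'i \<Rightarrow> nat \<Rightarrow> 'a \<Rightarrow> real" and \<mu> \<sigma> :: real
    and \<tau> :: "'i \<Rightarrow> nat \<Rightarrow> 'a \<Rightarrow> nat" and \<delta> :: "'i \<Rightarrow> real" and t :: "'i \<Rightarrow> nat" and A :: real
  assumes iid: "\<forall>\<^sub>F i in F. iid_sequence (M i) \<nu> (X i) \<mu> \<sigma>"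
    and ren: "\<forall>\<^sub>F i in F. renewal_sequence (M i) (\<tau> i)"
    and mean: "\<forall>\<^sub>F i in F. integral\<^sup>L (M i) (\<lambda>\<omega>. real (\<tau> i 1 \<omega>)) = \<delta> i"
    and \<delta>_pos: "\<forall>\<^sub>F i in F. \<delta> i > 0"
    and int: "\<forall>\<^sub>F i in F. integrable (M i) (\<lambda>\<omega>. (real (\<tau> i 1 \<omega>))\<^sup>2)"
    and A_pos: "A > 0"
    and second_moment: "\<forall>\<^sub>F i in F. integral\<^sup>L (M i) (\<lambda>\<omega>. (real (\<tau> i 1 \<omega>))\<^sup>2) \<le> A * (\<delta> i)\<^sup>2"
    and t: "filterlim t at_top F"
    and small: "((\<lambda>i. \<delta> i / real (t i)) \<longlongrightarrow> 0) F"
    and \<sigma>_pos: "\<sigma> > 0"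
begin

definition age :: "'i \<Rightarrow> 'a \<Rightarrow> real" where
  "age i \<omega> = real (t i - last_renewal (\<tau> i) (t i) \<omega>)"

definition full_sum :: "'i \<Rightarrow> 'a \<Rightarrow> real" where
  "full_sum i \<omega> = (partial_sum (X i) (t i) \<omega> - real (t i) * \<mu>) / (\<sigma> * sqrt (real (t i)))"

text \<open>Normalized by the square root of \<open>t i\<close> and not of the random index, so that
  its difference from \<open>full_sum\<close> is the quantity controlled by
  \<open>random_index_partial_sum\<close>.\<close>

definition sampled_sum :: "'i \<Rightarrow> 'a \<Rightarrow> real" where
  "sampled_sum i \<omega> = (partial_sum (X i) (last_renewal (\<tau> i) (t i) \<omega>) \<omega> -
     real (last_renewal (\<tau> i) (t i) \<omega>) * \<mu>) / (\<sigma> * sqrt (real (t i)))"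

lemma prob_spaces: "\<forall>\<^sub>F i in F. prob_space (M i)"
  using ren by eventually_elim (simp add: renewal_sequence_def)

lemma t_pos: "\<forall>\<^sub>F i in F. t i > 0"
  by (rule eventually_compose_filterlim[OF eventually_gt_at_top t])

lemma age_conv:
  assumes "((\<lambda>i. \<delta> i / b i) \<longlongrightarrow> 0) F" "\<forall>\<^sub>F i in F. b i > 0"
  shows "conv_in_prob F M (\<lambda>i \<omega>. age i \<omega> / b i) 0"
  unfolding age_def
  by (rule age_conv_in_prob_0[OF ren mean \<delta>_pos int A_pos second_moment assms])

lemma age_conv_t: "conv_in_prob F M (\<lambda>i \<omega>. age i \<omega> / real (t i)) 0"
  using t_pos by (intro age_conv small) auto

lemma sampled_minus_full: "conv_in_prob F M (\<lambda>i \<omega>. sampled_sum i \<omega> - full_sum i \<omega>) 0"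
  unfolding sampled_sum_def full_sum_def
proof (rule random_index_partial_sum[OF iid t])
  show "\<forall>\<^sub>F i in F. last_renewal (\<tau> i) (t i) \<in> measurable (M i) (count_space UNIV)"
    using ren by eventually_elim (rule renewal_sequence.measurable_last_renewal)
  show "\<forall>\<^sub>F i in F. \<forall>\<omega>\<in>space (M i). last_renewal (\<tau> i) (t i) \<omega> \<le> t i"
    using ren by eventually_elim (simp add: renewal_sequence.last_renewal_le)
qed (use age_conv_t in \<open>simp add: age_def\<close>)

lemma full_sum_conv: "conv_in_distr F M full_sum std_normal_distribution"
  unfolding full_sum_def[abs_def] by (rule central_limit_varying_space[OF iid t])

lemma bounded_sampled_sum: "bounded_in_prob F M sampled_sum"
  using bounded_in_prob_add[OF prob_spaces conv_in_prob_imp_bounded[OF prob_spaces sampled_minus_full]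
      bounded_in_prob_partial_sum[OF iid t]]
  by (simp add: full_sum_def)

lemma sigma_over_sqrt: "((\<lambda>i. \<sigma> / sqrt (real (t i))) \<longlongrightarrow> 0) F"
proof -
  have "filterlim (\<lambda>n. sqrt (real n)) at_top sequentially"
    by (intro filterlim_compose[OF sqrt_at_top] filterlim_real_sequentially)
  then have "((\<lambda>n. \<sigma> / sqrt (real n)) \<longlongrightarrow> 0) sequentially"
    by (rule real_tendsto_divide_at_top[OF tendsto_const])
  then show ?thesis by (rule filterlim_compose[OF _ t])
qed

lemma scale_conv_0:
  assumes "bounded_in_prob F M Y"
  shows "conv_in_prob F M (\<lambda>i \<omega>. Y i \<omega> * (\<sigma> / sqrt (real (t i)))) 0"
  by (rule conv_in_prob_mult_bounded[OF prob_spaces assms conv_in_prob_const[OF prob_spaces sigma_over_sqrt]])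

lemma last_eq:
  assumes "renewal_sequence (M i) (\<tau> i)" "\<omega> \<in> space (M i)"
  shows "real (last_renewal (\<tau> i) (t i) \<omega>) = real (t i) - age i \<omega>"
  using renewal_sequence.last_renewal_le[OF assms] by (simp add: age_def of_nat_diff)

text \<open>The error splits into a tight fluctuation times
  \<open>\<sigma> / sqrt (real (t i))\<close> and the bias
  \<open>- \<mu> * (age i \<omega> / real (t i))\<close>, caused by dividing by \<open>t i\<close> a
  sum of fewer terms.\<close>

lemma mu_tilde_conv_in_prob:
  "conv_in_prob F M (\<lambda>i. mu_tilde (X i) (\<tau> i) (t i)) \<mu>"
proof (rule conv_in_prob_cong)
  show "conv_in_prob F M (\<lambda>i \<omega>. sampled_sum i \<omega> * (\<sigma> / sqrt (real (t i))) + (- \<mu>) * (age i \<omega> / real (t i))) 0"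
    using conv_in_prob_add[OF prob_spaces scale_conv_0[OF bounded_sampled_sum]
        conv_in_prob_cmult[OF prob_spaces age_conv_t, of "- \<mu>"]] by (simp only: add_0_left)
  show "\<forall>\<^sub>F i in F. \<forall>\<omega>\<in>space (M i). mu_tilde (X i) (\<tau> i) (t i) \<omega> - \<mu> =
      sampled_sum i \<omega> * (\<sigma> / sqrt (real (t i))) + (- \<mu>) * (age i \<omega> / real (t i)) - 0"
    using ren t_pos
  proof eventually_elim
    case (elim i)
    show ?case
    proof
      fix \<omega> assume \<omega>: "\<omega> \<in> space (M i)"
      define S where "S = partial_sum (X i) (last_renewal (\<tau> i) (t i) \<omega>) \<omega>"
      have sampled_sum: "sampled_sum i \<omega> * (\<sigma> / sqrt (real (t i))) = (S - (real (t i) - age i \<omega>) * \<mu>) / real (t i)"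
        using \<sigma>_pos elim(2) by (simp add: sampled_sum_def S_def last_eq[OF elim(1) \<omega>])
      show "mu_tilde (X i) (\<tau> i) (t i) \<omega> - \<mu> =
          sampled_sum i \<omega> * (\<sigma> / sqrt (real (t i))) + (- \<mu>) * (age i \<omega> / real (t i)) - 0"
        unfolding sampled_sum mu_tilde_def S_def[symmetric] using elim(2) by (simp add: field_simps)
    qed
  qed
qed

text \<open>After normalization the bias is the age over the square root of \<open>t i\<close>,
  times \<open>- \<mu> / \<sigma>\<close>. The assumption on \<delta> makes it negligible, and
  Slutsky's theorem is applied around \<open>full_sum\<close>.\<close>

lemma mu_tilde_conv_in_distr:
  assumes "((\<lambda>i. \<delta> i / sqrt (real (t i))) \<longlongrightarrow> 0) F"
  shows "conv_in_distr F M (\<lambda>i \<omega>. (mu_tilde (X i) (\<tau> i) (t i) \<omega> - \<mu>) / (\<sigma> / sqrt (real (t i))))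
    std_normal_distribution"
proof (rule conv_in_distr_cong)
  have "conv_in_prob F M (\<lambda>i \<omega>. age i \<omega> / sqrt (real (t i))) 0"
    using t_pos by (intro age_conv assms) (auto elim: eventually_mono)
  from conv_in_prob_add[OF prob_spaces sampled_minus_full conv_in_prob_cmult[OF prob_spaces this, of "- \<mu> / \<sigma>"]]
  have "conv_in_prob F M (\<lambda>i \<omega>. sampled_sum i \<omega> - full_sum i \<omega> + - \<mu> / \<sigma> * (age i \<omega> / sqrt (real (t i)))) 0" by simp
  from Slutsky_add[OF prob_spaces full_sum_conv this isCont_cdf_std_normal]
  show "conv_in_distr F M
    (\<lambda>i \<omega>. full_sum i \<omega> + (sampled_sum i \<omega> - full_sum i \<omega> + - \<mu> / \<sigma> * (age i \<omega> / sqrt (real (t i))))) std_normal_distribution" .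
  show "\<forall>\<^sub>F i in F. \<forall>\<omega>\<in>space (M i). (mu_tilde (X i) (\<tau> i) (t i) \<omega> - \<mu>) / (\<sigma> / sqrt (real (t i))) =
      full_sum i \<omega> + (sampled_sum i \<omega> - full_sum i \<omega> + - \<mu> / \<sigma> * (age i \<omega> / sqrt (real (t i))))"
    using ren t_pos
  proof eventually_elim
    case (elim i)
    show ?case
    proof
      fix \<omega> assume \<omega>: "\<omega> \<in> space (M i)"
      define S where "S = partial_sum (X i) (last_renewal (\<tau> i) (t i) \<omega>) \<omega>"
      \<comment> \<open>Writing \<open>t i\<close> as \<open>w * w\<close> turns the claim into an
        identity of rational expressions.\<close>
      define w where "w = sqrt (real (t i))"
      have w: "w > 0" "real (t i) = w * w" using elim(2) by (simp_all add: w_def)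
      show "(mu_tilde (X i) (\<tau> i) (t i) \<omega> - \<mu>) / (\<sigma> / sqrt (real (t i))) =
          full_sum i \<omega> + (sampled_sum i \<omega> - full_sum i \<omega> + - \<mu> / \<sigma> * (age i \<omega> / sqrt (real (t i))))"
        unfolding sampled_sum_def last_eq[OF elim(1) \<omega>] mu_tilde_def S_def[symmetric] w_def[symmetric] w(2)
        using w(1) \<sigma>_pos by (simp add: field_simps)
    qed
  qed
qed

section \<open>Division by the last renewal time, with arbitrary default values\<close>

context
  fixes v :: "'i \<Rightarrow> 'a \<Rightarrow> real"
  assumes v: "\<forall>\<^sub>F i in F. v i \<in> borel_measurable (M i)"
begin

text \<open>\<open>age_ratio\<close> has the junk value 0 when no renewal has occurred by time \<^term>\<open>t i\<close>.\<close>

definition age_ratio :: "'i \<Rightarrow> 'a \<Rightarrow> real" where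
  "age_ratio i \<omega> = age i \<omega> / real (last_renewal (\<tau> i) (t i) \<omega>)"

text \<open>Exactly what must be added for the decomposition of the normalized mean to hold also
  before the first renewal. Its size there is uncontrolled, since \<open>v\<close> is
  arbitrary.\<close>

definition default_error :: "'i \<Rightarrow> 'a \<Rightarrow> real" where
  "default_error i \<omega> = (if \<tau> i 1 \<omega> \<le> t i then 0 else (v i \<omega> - \<mu>) / (\<sigma> / sqrt (real (t i))) - sampled_sum i \<omega>)"

text \<open>If the age is at most \<open>\<epsilon> * real (t i)\<close> with
  \<open>\<epsilon> \<le> 1 / 2\<close>, the last renewal is at least half of \<open>t i\<close>, so
  the ratio is at most \<open>2 * \<epsilon>\<close>.\<close>

lemma age_ratio_conv: "conv_in_prob F M age_ratio 0"
proof (rule conv_in_prob_mono[OF prob_spaces _ age_conv_t])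
  show "\<forall>\<^sub>F i in F. age_ratio i \<in> borel_measurable (M i)"
    using ren
  proof eventually_elim
    case (elim i)
    interpret renewal_sequence "M i" "\<tau> i" by fact
    show ?case unfolding age_ratio_def[abs_def] age_def by measurable
  qed
  fix \<eta> :: real assume "\<eta> > 0"
  define \<epsilon> where "\<epsilon> = min (1 / 2) (\<eta> / 2)"
  have \<epsilon>: "\<epsilon> > 0" "\<epsilon> \<le> 1 / 2" "2 * \<epsilon> \<le> \<eta>" using \<open>\<eta> > 0\<close> by (auto simp: \<epsilon>_def)
  have "\<forall>\<^sub>F i in F. \<forall>\<omega>\<in>space (M i). \<bar>age_ratio i \<omega>\<bar> > \<eta> \<longrightarrow> \<bar>age i \<omega> / real (t i)\<bar> > \<epsilon>"
    using ren t_pos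
  proof eventually_elim
    case (elim i)
    show ?case
    proof (intro ballI impI, rule ccontr)
      fix \<omega> assume \<omega>: "\<omega> \<in> space (M i)" and age_ratio: "\<bar>age_ratio i \<omega>\<bar> > \<eta>" and "\<not> \<bar>age i \<omega> / real (t i)\<bar> > \<epsilon>"
      then have age: "age i \<omega> \<le> \<epsilon> * real (t i)" "age i \<omega> \<ge> 0"
        using elim(2) by (simp_all add: age_def field_simps)
      have "\<epsilon> * real (t i) \<le> 1 / 2 * real (t i)" using \<epsilon>(2) by (intro mult_right_mono) auto
      then have l: "real (last_renewal (\<tau> i) (t i) \<omega>) \<ge> real (t i) / 2"
        using age(1) last_eq[OF elim(1) \<omega>] by simp
      have "age_ratio i \<omega> \<le> \<epsilon> * real (t i) / (real (t i) / 2)"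
        unfolding age_ratio_def using age l elim(2) \<epsilon>(1) by (intro frac_le) auto
      also have "\<dots> \<le> \<eta>" using elim(2) \<epsilon>(3) by simp
      finally show False using age_ratio age(2) by (simp add: age_ratio_def)
    qed
  qed
  then show "\<exists>\<epsilon>>0. \<forall>\<^sub>F i in F. \<forall>\<omega>\<in>space (M i). \<bar>age_ratio i \<omega>\<bar> > \<eta> \<longrightarrow> \<bar>age i \<omega> / real (t i)\<bar> > \<epsilon>"
    using \<epsilon>(1) by blast
qed

text \<open>A nonzero value means that no renewal has occurred, and then the age divided by
  \<open>t i\<close> equals 1.\<close>

lemma default_error_conv: "conv_in_prob F M default_error 0"
proof (rule conv_in_prob_mono[OF prob_spaces _ age_conv_t])
  have "\<forall>\<^sub>F i in F. sampled_sum i \<in> borel_measurable (M i)"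
    using bounded_sampled_sum by (simp add: bounded_in_prob_def)
  with v ren show "\<forall>\<^sub>F i in F. default_error i \<in> borel_measurable (M i)"
  proof eventually_elim
    case (elim i)
    interpret renewal_sequence "M i" "\<tau> i" by fact
    note [measurable] = elim(1,3)
    show ?case unfolding default_error_def[abs_def] by measurable
  qed
  fix \<eta> :: real assume "\<eta> > 0"
  have "\<forall>\<^sub>F i in F. \<forall>\<omega>\<in>space (M i). \<bar>default_error i \<omega>\<bar> > \<eta> \<longrightarrow> \<bar>age i \<omega> / real (t i)\<bar> > 1 / 2"
    using ren t_pos
    by eventually_elim (use \<open>\<eta> > 0\<close> in \<open>auto simp: default_error_def age_def renewal_sequence.last_renewal_eq_0\<close>)
  then show "\<exists>\<epsilon>>0. \<forall>\<^sub>F i in F. \<forall>\<omega>\<in>space (M i). \<bar>default_error i \<omega>\<bar> > \<eta> \<longrightarrow> \<bar>age i \<omega> / real (t i)\<bar> > \<epsilon>"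
    by (intro exI[of _ "1 / 2"]) auto
qed

text \<open>Dividing by the last renewal time instead of \<open>t i\<close> multiplies by their
  quotient, which is 1 plus \<open>age_ratio\<close>. Before the first renewal
  \<open>age_ratio\<close> is 0 and \<open>default_error\<close> cancels
  \<open>sampled_sum\<close>.\<close>

lemma normalized_mu_bar_eq:
  "\<forall>\<^sub>F i in F. \<forall>\<omega>\<in>space (M i).
     (mu_bar (v i) (X i) (\<tau> i) (t i) \<omega> - \<mu>) / (\<sigma> / sqrt (real (t i))) = sampled_sum i \<omega> + (sampled_sum i \<omega> * age_ratio i \<omega> + default_error i \<omega>)"
  using ren t_pos
proof eventually_elim
  case (elim i)
  show ?case
  proof
    fix \<omega> assume \<omega>: "\<omega> \<in> space (M i)"
    show "(mu_bar (v i) (X i) (\<tau> i) (t i) \<omega> - \<mu>) / (\<sigma> / sqrt (real (t i))) =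
      sampled_sum i \<omega> + (sampled_sum i \<omega> * age_ratio i \<omega> + default_error i \<omega>)"
    proof (cases "\<tau> i 1 \<omega> \<le> t i")
      case True
      define S where "S = partial_sum (X i) (last_renewal (\<tau> i) (t i) \<omega>) \<omega>"
      define k where "k = real (last_renewal (\<tau> i) (t i) \<omega>)"
      define w where "w = sqrt (real (t i))"
      have w: "w > 0" "real (t i) = w * w" using elim(2) by (simp_all add: w_def)
      have k: "k > 0" using renewal_sequence.last_renewal_pos[OF elim(1) \<omega> True] by (simp add: k_def)
      have age: "age i \<omega> = w * w - k" using last_eq[OF elim(1) \<omega>] by (simp add: k_def w(2))
      have "sampled_sum i \<omega> + sampled_sum i \<omega> * age_ratio i \<omega> = sampled_sum i \<omega> * (w * w / k)"
        unfolding age_ratio_def age k_def[symmetric] using k by (simp add: field_simps)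
      also have "\<dots> = (S / k - \<mu>) / (\<sigma> / w)"
        unfolding sampled_sum_def S_def[symmetric] k_def[symmetric] w_def[symmetric]
        using k w(1) \<sigma>_pos by (simp add: field_simps)
      finally show ?thesis
        using True by (simp add: mu_bar_def default_error_def S_def k_def w_def)
    next
      case False
      then have "age_ratio i \<omega> = 0"
        using renewal_sequence.last_renewal_eq_0[OF elim(1) \<omega> False] by (simp add: age_ratio_def)
      with False show ?thesis by (simp add: mu_bar_def default_error_def)
    qed
  qed
qed

lemma correction_conv: "conv_in_prob F M (\<lambda>i \<omega>. sampled_sum i \<omega> * age_ratio i \<omega> + default_error i \<omega>) 0"
  using conv_in_prob_add[OF prob_spaces conv_in_prob_mult_bounded[OF prob_spaces bounded_sampled_sum age_ratio_conv] default_error_conv]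
  by simp

text \<open>Consistency comes from tightness of the normalized error: multiplying it by
  \<open>\<sigma> / sqrt (real (t i))\<close>, which tends to 0, recovers the error itself.\<close>

lemma mu_bar_conv_in_prob: "conv_in_prob F M (\<lambda>i. mu_bar (v i) (X i) (\<tau> i) (t i)) \<mu>"
proof (rule conv_in_prob_cong)
  show "conv_in_prob F M
    (\<lambda>i \<omega>. (sampled_sum i \<omega> + (sampled_sum i \<omega> * age_ratio i \<omega> + default_error i \<omega>)) * (\<sigma> / sqrt (real (t i)))) 0"
    by (intro scale_conv_0 bounded_in_prob_add prob_spaces bounded_sampled_sum
        conv_in_prob_imp_bounded[OF prob_spaces correction_conv])
  show "\<forall>\<^sub>F i in F. \<forall>\<omega>\<in>space (M i). mu_bar (v i) (X i) (\<tau> i) (t i) \<omega> - \<mu> =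
      (sampled_sum i \<omega> + (sampled_sum i \<omega> * age_ratio i \<omega> + default_error i \<omega>)) * (\<sigma> / sqrt (real (t i))) - 0"
    using normalized_mu_bar_eq t_pos
  proof eventually_elim
    case (elim i)
    have "\<sigma> / sqrt (real (t i)) \<noteq> 0" using \<sigma>_pos elim(2) by simp
    from nonzero_divide_eq_eq[OF this] show ?case using elim(1) unfolding diff_0_right by blast
  qed
qed

lemma mu_bar_conv_in_distr:
  "conv_in_distr F M (\<lambda>i \<omega>. (mu_bar (v i) (X i) (\<tau> i) (t i) \<omega> - \<mu>) / (\<sigma> / sqrt (real (t i))))
     std_normal_distribution"
proof (rule conv_in_distr_cong)
  have "conv_in_prob F M (\<lambda>i \<omega>. sampled_sum i \<omega> - full_sum i \<omega> + (sampled_sum i \<omega> * age_ratio i \<omega> + default_error i \<omega>)) 0"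
    using conv_in_prob_add[OF prob_spaces sampled_minus_full correction_conv] by simp
  from Slutsky_add[OF prob_spaces full_sum_conv this isCont_cdf_std_normal]
  show "conv_in_distr F M (\<lambda>i \<omega>. full_sum i \<omega> + (sampled_sum i \<omega> - full_sum i \<omega> + (sampled_sum i \<omega> * age_ratio i \<omega> + default_error i \<omega>)))
    std_normal_distribution" .
  show "\<forall>\<^sub>F i in F. \<forall>\<omega>\<in>space (M i).
     (mu_bar (v i) (X i) (\<tau> i) (t i) \<omega> - \<mu>) / (\<sigma> / sqrt (real (t i))) =
     full_sum i \<omega> + (sampled_sum i \<omega> - full_sum i \<omega> + (sampled_sum i \<omega> * age_ratio i \<omega> + default_error i \<omega>))"
    using normalized_mu_bar_eq by eventually_elim simp
qed

end

end

section \<open>The two limit theorems along joint limits\<close>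

theorem theorem3p1:
  fixes D :: "real set"
    and M :: "real \<Rightarrow> 'a measure"
    and X :: "real \<Rightarrow> nat \<Rightarrow> 'a \<Rightarrow> real"
    and \<tau> :: "real \<Rightarrow> nat \<Rightarrow> 'a \<Rightarrow> nat"
    and v :: "real \<Rightarrow> nat \<Rightarrow> 'a \<Rightarrow> real"
    and \<nu> :: "real measure"
    and \<mu> \<sigma> :: real
  assumes "\<And>\<delta>. \<delta> \<in> D \<Longrightarrow> prob_space (M \<delta>)"
    and "\<And>\<delta>. \<delta> \<in> D \<Longrightarrow> iid (M \<delta>) borel \<nu> {1..} (X \<delta>)"
    and "\<And>\<delta> i. \<delta> \<in> D \<Longrightarrow> i \<ge> 1 \<Longrightarrow> integrable (M \<delta>) (\<lambda>\<omega>. (X \<delta> i \<omega>)\<^sup>2)"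
    and "\<And>\<delta> i. \<delta> \<in> D \<Longrightarrow> i \<ge> 1 \<Longrightarrow> prob_space.expectation (M \<delta>) (X \<delta> i) = \<mu>"
    and "\<And>\<delta> i. \<delta> \<in> D \<Longrightarrow> i \<ge> 1 \<Longrightarrow> sqrt (prob_space.variance (M \<delta>) (X \<delta> i)) = \<sigma>"
    and "\<sigma> > 0"
    and "\<And>\<delta>. \<delta> \<in> D \<Longrightarrow> renewal_process (M \<delta>) (\<tau> \<delta>)"
    and "\<And>\<delta>. \<delta> \<in> D \<Longrightarrow> integrable (M \<delta>) (\<lambda>\<omega>. real (\<tau> \<delta> 1 \<omega>))"
    and "\<And>\<delta>. \<delta> \<in> D \<Longrightarrow> prob_space.expectation (M \<delta>) (\<lambda>\<omega>. real (\<tau> \<delta> 1 \<omega>)) = \<delta>"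
    and "\<forall>\<^sub>F \<delta> in inf at_top (principal D). integrable (M \<delta>) (\<lambda>\<omega>. (real (\<tau> \<delta> 1 \<omega>))\<^sup>2)"
    and "(\<lambda>\<delta>. prob_space.variance (M \<delta>) (\<lambda>\<omega>. real (\<tau> \<delta> 1 \<omega>)))
           \<in> O[inf at_top (principal D)](\<lambda>\<delta>. \<delta>\<^sup>2)"
    and "\<And>\<delta> t. \<delta> \<in> D \<Longrightarrow> v \<delta> t \<in> borel_measurable (M \<delta>)"
  shows
    "(\<forall>F. joint_limit D F \<longrightarrow>
        conv_in_prob F (\<lambda>(\<delta>, t). M \<delta>) (\<lambda>(\<delta>, t). mu_bar (v \<delta> t) (X \<delta>) (\<tau> \<delta>) t) \<mu> \<and>
        conv_in_distr F (\<lambda>(\<delta>, t). M \<delta>)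
          (\<lambda>(\<delta>, t) \<omega>. (mu_bar (v \<delta> t) (X \<delta>) (\<tau> \<delta>) t \<omega> - \<mu>) / (\<sigma> / sqrt (real t)))
          std_normal_distribution) \<and>
     (\<forall>F. joint_limit D F \<longrightarrow>
        conv_in_prob F (\<lambda>(\<delta>, t). M \<delta>) (\<lambda>(\<delta>, t). mu_tilde (X \<delta>) (\<tau> \<delta>) t) \<mu> \<and>
        ((\<lambda>(\<delta>, t). \<delta>) \<in> o[F](\<lambda>(\<delta>, t). sqrt (real t)) \<longrightarrow>
         conv_in_distr F (\<lambda>(\<delta>, t). M \<delta>)
           (\<lambda>(\<delta>, t) \<omega>. (mu_tilde (X \<delta>) (\<tau> \<delta>) t \<omega> - \<mu>) / (\<sigma> / sqrt (real t)))
           std_normal_distribution))"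
proof -
  \<comment> \<open>The index of the family is the pair of parameters itself, so each joint limit is
    one instance of the sampling setting.\<close>
  have core: "\<exists>A. renewal_sampling F (\<lambda>p. M (fst p)) \<nu> (\<lambda>p. X (fst p)) \<mu> \<sigma> (\<lambda>p. \<tau> (fst p)) fst snd A"
    if F: "joint_limit D F" for F
  proof -
    have inD: "\<forall>\<^sub>F p in F. fst p \<in> D" and \<delta>: "filterlim fst at_top F" and t: "filterlim snd at_top F"
      and small: "(\<lambda>p. fst p) \<in> o[F](\<lambda>p. real (snd p))"
      using F by (simp_all add: joint_limit_def case_prod_beta')
    \<comment> \<open>Lets the asymptotic hypotheses, stated for \<delta> tending to infinity within
      \<open>D\<close>, be pulled back to the joint limit.\<close>
    have \<delta>D: "filterlim fst (inf at_top (principal D)) F"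
      using \<delta> inD by (simp add: filterlim_inf filterlim_principal)
    obtain C where "C > 0" and C: "\<forall>\<^sub>F \<delta> in inf at_top (principal D).
        norm (prob_space.variance (M \<delta>) (\<lambda>\<omega>. real (\<tau> \<delta> 1 \<omega>))) \<le> C * norm (\<delta>\<^sup>2)"
      using assms(11) by (rule landau_o.bigE)
    have int: "\<forall>\<^sub>F p in F. integrable (M (fst p)) (\<lambda>\<omega>. (real (\<tau> (fst p) 1 \<omega>))\<^sup>2)"
      by (rule eventually_compose_filterlim[OF assms(10) \<delta>D])
    \<comment> \<open>The second moment is the variance plus the squared mean: \<open>C\<close>
      bounds the first relative to the square of \<open>fst p\<close>, and the mean
      \<open>fst p\<close> accounts for the added 1.\<close>
    have "\<forall>\<^sub>F p in F. integral\<^sup>L (M (fst p)) (\<lambda>\<omega>. (real (\<tau> (fst p) 1 \<omega>))\<^sup>2) \<le> (C + 1) * (fst p)\<^sup>2"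
      using int eventually_compose_filterlim[OF C \<delta>D] inD
    proof eventually_elim
      case (elim p)
      interpret prob_space "M (fst p)" using elim(3) assms(1) by blast
      have "variance (\<lambda>\<omega>. real (\<tau> (fst p) 1 \<omega>)) =
          expectation (\<lambda>\<omega>. (real (\<tau> (fst p) 1 \<omega>))\<^sup>2) - (fst p)\<^sup>2"
        using variance_eq[OF assms(8)[OF elim(3)] elim(1)] assms(9)[OF elim(3)] by simp
      with elim(2) show ?case by (simp add: distrib_right)
    qed
    moreover have "\<forall>\<^sub>F p in F. iid_sequence (M (fst p)) \<nu> (X (fst p)) \<mu> \<sigma>"
      using inD
    proof eventually_elim
      case (elim p)
      interpret prob_space "M (fst p)" using elim assms(1) by blast
      have "variance (X (fst p) i) = \<sigma>\<^sup>2" if "i \<ge> 1" for i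
        using assms(5)[OF elim that] variance_positive[of "X (fst p) i"] by auto
      then show ?case
        using assms(2,3,4)[OF elim] assms(6) by unfold_locales auto
    qed
    moreover have "\<forall>\<^sub>F p in F. renewal_sequence (M (fst p)) (\<tau> (fst p))"
      using inD by eventually_elim
        (auto simp: renewal_sequence_def renewal_sequence_axioms_def assms(1,7))
    moreover have "\<forall>\<^sub>F p in F. integral\<^sup>L (M (fst p)) (\<lambda>\<omega>. real (\<tau> (fst p) 1 \<omega>)) = fst p"
      using inD by eventually_elim (rule assms(9))
    moreover have "\<forall>\<^sub>F p in F. fst p > 0"
      by (rule eventually_compose_filterlim[OF eventually_gt_at_top \<delta>])
    moreover have "((\<lambda>p. fst p / real (snd p)) \<longlongrightarrow> 0) F"
      using small by (rule smalloD_tendsto)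
    ultimately have "renewal_sampling F (\<lambda>p. M (fst p)) \<nu> (\<lambda>p. X (fst p)) \<mu> \<sigma> (\<lambda>p. \<tau> (fst p)) fst snd (C + 1)"
      using int t \<open>C > 0\<close> assms(6) by unfold_locales auto
    then show ?thesis by blast
  qed
  have "conv_in_prob F (\<lambda>p. M (fst p)) (\<lambda>p. mu_bar (v (fst p) (snd p)) (X (fst p)) (\<tau> (fst p)) (snd p)) \<mu> \<and>
      conv_in_distr F (\<lambda>p. M (fst p))
        (\<lambda>p \<omega>. (mu_bar (v (fst p) (snd p)) (X (fst p)) (\<tau> (fst p)) (snd p) \<omega> - \<mu>) / (\<sigma> / sqrt (real (snd p))))
        std_normal_distribution \<and>
      conv_in_prob F (\<lambda>p. M (fst p)) (\<lambda>p. mu_tilde (X (fst p)) (\<tau> (fst p)) (snd p)) \<mu> \<and>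
      ((\<lambda>p. fst p) \<in> o[F](\<lambda>p. sqrt (real (snd p))) \<longrightarrow>
        conv_in_distr F (\<lambda>p. M (fst p))
          (\<lambda>p \<omega>. (mu_tilde (X (fst p)) (\<tau> (fst p)) (snd p) \<omega> - \<mu>) / (\<sigma> / sqrt (real (snd p))))
          std_normal_distribution)"
    if F: "joint_limit D F" for F
  proof -
    obtain A where "renewal_sampling F (\<lambda>p. M (fst p)) \<nu> (\<lambda>p. X (fst p)) \<mu> \<sigma> (\<lambda>p. \<tau> (fst p)) fst snd A"
      using core[OF F] by blast
    then interpret renewal_sampling F "\<lambda>p. M (fst p)" \<nu> "\<lambda>p. X (fst p)" \<mu> \<sigma> "\<lambda>p. \<tau> (fst p)" fst snd A .
    have "\<forall>\<^sub>F p in F. fst p \<in> D" using F by (simp add: joint_limit_def)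
    then have v: "\<forall>\<^sub>F p in F. v (fst p) (snd p) \<in> borel_measurable (M (fst p))"
      by eventually_elim (rule assms(12))
    show ?thesis
      using mu_bar_conv_in_prob[OF v] mu_bar_conv_in_distr[OF v] mu_tilde_conv_in_prob
        mu_tilde_conv_in_distr smalloD_tendsto by blast
  qed
  then show ?thesis by (simp add: case_prod_beta')
qed

end
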